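(* Let $P$ be a well-founded poset and let $(C,d)$ be a $P$-graded chain complex of vector spaces over a field. Suppose that for each $p\in P$ a homology decomposition $\zeta^p_n\colon C^p_n \xrightarrow{\cong} H^p_n\oplus B^p_n\oplus B^p_{n-1}$ ($n\in\mathbb Z$) of the relative chain complex $(C^p,t^p)$ is given. Let $\alpha,\beta,\gamma,\delta$ be the maps constructed from $d$ and the $\zeta^p$ as in the context. Then these data induce a $P$-filtered contraction $(\bar\alpha,\bar\beta,\bar\gamma)$ of $(C,d)$ to a Conley complex $(\bar C,\bar d)$ of $(C,d)$, where $\bar C_n=\bigoplus_{p\in P}H^p_n$ and $\bar d=\alpha\,\delta(1-\gamma\delta)^{-1}\beta$. Here the induced maps are $\bar\alpha=\alpha+\alpha\mathcal S\gamma\colon C\to\bar C$, $\bar\beta=\beta+\gamma\mathcal S\beta\colon\bar C\to C$, $\bar\gamma=\gamma+\gamma\mathcal S\gamma$, with $\mathcal S=\delta(1-\gamma\delta)^{-1}=\sum_{i\ge 0}\delta(\gamma\delta)^i$.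
   Context: A poset $P$ is well-founded if it has no infinite strictly descending sequence. Chain complexes are $\mathbb Z$-indexed complexes of vector spaces over a fixed field, with $d_n\colon C_n\to C_{n-1}$. A vector space $V$ is $P$-graded if $V=\bigoplus_{p\in P}V^p$; $\imath^p\colon V^p\hookrightarrow V$ and $\jmath^p\colon V\twoheadrightarrow V^p$ are the inclusion and projection. For a linear map $f$ between $P$-graded spaces put $f^{pq}=\jmath^p f\imath^q$, $f^p=f^{pp}$; $f$ is $P$-filtered if $f^{pq}\neq0$ implies $p\le q$. A chain complex $(C,d)$ is $P$-graded if every $C_n=\bigoplus_p C^p_n$ is $P$-graded and every $d_n$ is $P$-filtered. Put $t^{pq}_n=\jmath^p d_n\imath^q\colon C^q_n\to C^p_{n-1}$ and $t^p=t^{pp}$; then $(C^p,t^p)$ is a chain complex, the relative chain complex at $p$. The differential $d$ is strict if $t^p_n=0$ for all $p,n$. A contraction of $(C,d)$ to $(C',d')$ is a triple $(f,g,h)$ with chain maps $f\colon C\to C'$, $g\colon C'\to C$ and linear maps $h_n\colon C_n\to C_{n+1}$ such that $fg=1$, $gf=1+dh+hd$, $fh=0$, $hg=0$, $h^2=0$. It is $P$-filtered if $f,g,h$ are. A chain homotopy equivalence of $P$-graded complexes is $P$-filtered if both chain maps and both homotopies are $P$-filtered. A Conley complex of $(C,d)$ is a $P$-graded chain complex $(\bar C,\bar d)$ such that (M1) there is a $P$-filtered chain homotopy equivalence $(C,d)\simeq(\bar C,\bar d)$ and (M2) $\bar d$ is strict. Homology decomposition of $(C^p,t^p)$: let $B^p_n=\operatorname{im}(t^p_{n+1})$,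 $K^p_n:=B^p_{n-1}$, $H^p_n=H_n(C^p)=\ker t^p_n/B^p_n$. A homology decomposition is a family of isomorphisms $\zeta^p_n\colon C^p_n\to H^p_n\oplus B^p_n\oplus K^p_n$ such that $\zeta^p_{n-1}t^p_n(\zeta^p_n)^{-1}(h,b,k)=(0,k,0)$ for all $n$ (using $K^p_n=B^p_{n-1}$). Construction of maps: $\alpha^p_n\colon C^p_n\to H^p_n$ is $\zeta^p_n$ followed by projection to $H^p_n$; $\beta^p_n\colon H^p_n\to C^p_n$ is the inclusion into $H^p_n\oplus B^p_n\oplus K^p_n$ followed by $(\zeta^p_n)^{-1}$; $\gamma^p_n\colon C^p_n\to C^p_{n+1}$ is $-1$ times the composite of $\zeta^p_n$, projection to $B^p_n=K^p_{n+1}$, inclusion into $H^p_{n+1}\oplus B^p_{n+1}\oplus K^p_{n+1}$, and $(\zeta^p_{n+1})^{-1}$. With $\bar\imath^p,\bar\jmath^p$ the inclusion and projection of the summand $\bar C^p_n=H^p_n$ of $\bar C_n$, set $\alpha=\sum_p\bar\imath^p\alpha^p\jmath^p$, $\beta=\sum_p\imath^p\beta^p\bar\jmath^p$, $\gamma=\sum_p\imath^p\gamma^p\jmath^p$, $\widehat d=\sum_p\imath^p t^p\jmath^p$, and $\delta=d-\widehat d=\sum_{p<q}\imath^pt^{pq}\jmath^q$. *)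

theory Defs
  imports "Jordan_Normal_Form.Missing_VectorSpace" "HOL-Algebra.QuotRing"
begin

section \<open>Graded vector spaces\<close>

text \<open>
  A \<open>P\<close>-graded vector space is given by the family of its summands \<open>V p\<close>; its total space is the
  direct sum \<open>dsum V\<close>, consisting of the finitely supported families. The poset \<open>P\<close> is
  a type of class \<^class>\<open>order\<close>. Linear maps are total HOL functions that are only
  relevant on the carriers. The ring multiplication and unit, which \<^type>\<open>module_ext\<close> inherits
  from rings, play no role for a vector space and are filled with zero, as in \<^const>\<open>direct_sum\<close>.
\<close>

definition dsum :: "('p \<Rightarrow> ('k, 'a) module) \<Rightarrow> ('k, 'p \<Rightarrow> 'a) module" where
  "dsum V =
     \<lparr>carrier = {x. (\<forall>p. x p \<in> carrier (V p)) \<and> finite {p. x p \<noteq> \<zero>\<^bsub>V p\<^esub>}},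
      mult = (\<lambda>x y p. \<zero>\<^bsub>V p\<^esub>),
      one = (\<lambda>p. \<zero>\<^bsub>V p\<^esub>),
      zero = (\<lambda>p. \<zero>\<^bsub>V p\<^esub>),
      add = (\<lambda>x y p. x p \<oplus>\<^bsub>V p\<^esub> y p),
      smult = (\<lambda>c x p. c \<odot>\<^bsub>V p\<^esub> x p)\<rparr>"

lemma dsum_vectorspace:
  assumes "\<And>p. vectorspace K (V p)"
  shows "vectorspace K (dsum V)"
proof -
  interpret V: vectorspace K "V p" for p by (fact assms)
  have fin: "finite {p. x p \<oplus>\<^bsub>V p\<^esub> y p \<noteq> \<zero>\<^bsub>V p\<^esub>}"
    if "finite {p. x p \<noteq> \<zero>\<^bsub>V p\<^esub>}" "finite {p. y p \<noteq> \<zero>\<^bsub>V p\<^esub>}" for x y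
    by (rule finite_subset[OF _ finite_UnI[OF that]]) auto
  have fins: "finite {p. c \<odot>\<^bsub>V p\<^esub> x p \<noteq> \<zero>\<^bsub>V p\<^esub>}"
    if "finite {p. x p \<noteq> \<zero>\<^bsub>V p\<^esub>}" "c \<in> carrier K" for c x
    by (rule finite_subset[OF _ that(1)]) (use that(2) in auto)
  have inv: "\<exists>y\<in>carrier (dsum V). y \<oplus>\<^bsub>dsum V\<^esub> x = \<zero>\<^bsub>dsum V\<^esub>" if x: "x \<in> carrier (dsum V)" for x
  proof (rule bexI)
    let ?y = "\<lambda>p. \<ominus>\<^bsub>V p\<^esub> x p"
    have "{p. ?y p \<noteq> \<zero>\<^bsub>V p\<^esub>} \<subseteq> {p. x p \<noteq> \<zero>\<^bsub>V p\<^esub>}" by auto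
    then show "?y \<in> carrier (dsum V)"
      using x by (auto simp: dsum_def intro: finite_subset)
    show "?y \<oplus>\<^bsub>dsum V\<^esub> x = \<zero>\<^bsub>dsum V\<^esub>"
      using x by (auto simp: dsum_def V.M.l_neg)
  qed
  have "abelian_group (dsum V)"
    by (rule abelian_groupI)
      (use inv in \<open>auto simp: dsum_def fin V.M.a_assoc intro!: ext V.M.a_comm\<close>)
  then have "module K (dsum V)"
    by (intro moduleI V.R.is_cring)
      (auto simp: dsum_def fins V.smult_l_distr V.smult_r_distr V.smult_assoc1)
  then show ?thesis
    by (intro vectorspace.intro) (auto intro: V.field_axioms)
qed

definition ginc :: "('p \<Rightarrow> ('k, 'a) module) \<Rightarrow> 'p \<Rightarrow> 'a \<Rightarrow> 'p \<Rightarrow> 'a" where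
  "ginc V p v = (\<lambda>q. if q = p then v else \<zero>\<^bsub>V q\<^esub>)"

definition gproj :: "'p \<Rightarrow> ('p \<Rightarrow> 'a) \<Rightarrow> 'a" where
  "gproj p x = x p"

text \<open>\<open>component V f p q\<close> is the entry $f^{pq}$, a map from \<open>V q\<close> to the summand at \<open>p\<close>.\<close>

definition component ::
    "('p \<Rightarrow> ('k, 'a) module) \<Rightarrow> (('p \<Rightarrow> 'a) \<Rightarrow> 'p \<Rightarrow> 'b) \<Rightarrow> 'p \<Rightarrow> 'p \<Rightarrow> 'a \<Rightarrow> 'b" where
  "component V f p q v = gproj p (f (ginc V q v))"

definition filtered ::
    "('p::order \<Rightarrow> ('k, 'a) module) \<Rightarrow> ('p \<Rightarrow> ('k, 'b) module) \<Rightarrow> (('p \<Rightarrow> 'a) \<Rightarrow> 'p \<Rightarrow> 'b) \<Rightarrow> bool" where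
  "filtered V W f \<longleftrightarrow>
     (\<forall>p q. (\<exists>v\<in>carrier (V q). component V f p q v \<noteq> \<zero>\<^bsub>W p\<^esub>) \<longrightarrow> p \<le> q)"

text \<open>
  \<open>graded_sum V W \<phi>\<close> is the map $\sum_p \imath^p \varphi^p \jmath^p$. On each argument \<open>x\<close> only the
  finitely many \<open>p\<close> in the support of \<open>x\<close> contribute.
\<close>

definition graded_sum ::
    "('p \<Rightarrow> ('k, 'a) module) \<Rightarrow> ('p \<Rightarrow> ('k, 'b) module) \<Rightarrow> ('p \<Rightarrow> 'a \<Rightarrow> 'b) \<Rightarrow> ('p \<Rightarrow> 'a) \<Rightarrow> 'p \<Rightarrow> 'b" where
  "graded_sum V W \<phi> x =
     (\<Oplus>\<^bsub>dsum W\<^esub>p\<in>{p. gproj p x \<noteq> \<zero>\<^bsub>V p\<^esub>}. ginc W p (\<phi> p (gproj p x)))"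


section \<open>Chain complexes, homotopies, contractions\<close>

definition chain_complex ::
    "('k, 'r) ring_scheme \<Rightarrow> (int \<Rightarrow> ('k, 'a) module) \<Rightarrow> (int \<Rightarrow> 'a \<Rightarrow> 'a) \<Rightarrow> bool" where
  "chain_complex K X d \<longleftrightarrow>
     (\<forall>n. linear_map K (X n) (X (n - 1)) (d n)) \<and>
     (\<forall>n. \<forall>x\<in>carrier (X n). d (n - 1) (d n x) = \<zero>\<^bsub>X (n - 2)\<^esub>)"

definition chain_map ::
    "('k, 'r) ring_scheme \<Rightarrow> (int \<Rightarrow> ('k, 'a) module) \<Rightarrow> (int \<Rightarrow> 'a \<Rightarrow> 'a) \<Rightarrow>
     (int \<Rightarrow> ('k, 'b) module) \<Rightarrow> (int \<Rightarrow> 'b \<Rightarrow> 'b) \<Rightarrow> (int \<Rightarrow> 'a \<Rightarrow> 'b) \<Rightarrow> bool" where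
  "chain_map K X d Y e f \<longleftrightarrow>
     (\<forall>n. linear_map K (X n) (Y n) (f n)) \<and>
     (\<forall>n. \<forall>x\<in>carrier (X n). f (n - 1) (d n x) = e n (f n x))"

definition null_homotopy_of_difference ::
    "('k, 'r) ring_scheme \<Rightarrow> (int \<Rightarrow> ('k, 'a) module) \<Rightarrow> (int \<Rightarrow> 'a \<Rightarrow> 'a) \<Rightarrow>
     (int \<Rightarrow> 'a \<Rightarrow> 'a) \<Rightarrow> (int \<Rightarrow> 'a \<Rightarrow> 'a) \<Rightarrow> bool" where
  "null_homotopy_of_difference K X d \<phi> h \<longleftrightarrow>
     (\<forall>n. linear_map K (X n) (X (n + 1)) (h n)) \<and>
     (\<forall>n. \<forall>x\<in>carrier (X n). \<phi> n x = x \<oplus>\<^bsub>X n\<^esub> d (n + 1) (h n x) \<oplus>\<^bsub>X n\<^esub> h (n - 1) (d n x))"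

definition homotopy_equivalence ::
    "('k, 'r) ring_scheme \<Rightarrow> (int \<Rightarrow> ('k, 'a) module) \<Rightarrow> (int \<Rightarrow> 'a \<Rightarrow> 'a) \<Rightarrow>
     (int \<Rightarrow> ('k, 'b) module) \<Rightarrow> (int \<Rightarrow> 'b \<Rightarrow> 'b) \<Rightarrow>
     (int \<Rightarrow> 'a \<Rightarrow> 'b) \<Rightarrow> (int \<Rightarrow> 'b \<Rightarrow> 'a) \<Rightarrow> (int \<Rightarrow> 'a \<Rightarrow> 'a) \<Rightarrow> (int \<Rightarrow> 'b \<Rightarrow> 'b) \<Rightarrow> bool" where
  "homotopy_equivalence K X d Y e f g h k \<longleftrightarrow>
     chain_map K X d Y e f \<and> chain_map K Y e X d g \<and>
     null_homotopy_of_difference K X d (\<lambda>n x. g n (f n x)) h \<and>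
     null_homotopy_of_difference K Y e (\<lambda>n y. f n (g n y)) k"

definition contraction ::
    "('k, 'r) ring_scheme \<Rightarrow> (int \<Rightarrow> ('k, 'a) module) \<Rightarrow> (int \<Rightarrow> 'a \<Rightarrow> 'a) \<Rightarrow>
     (int \<Rightarrow> ('k, 'b) module) \<Rightarrow> (int \<Rightarrow> 'b \<Rightarrow> 'b) \<Rightarrow>
     (int \<Rightarrow> 'a \<Rightarrow> 'b) \<Rightarrow> (int \<Rightarrow> 'b \<Rightarrow> 'a) \<Rightarrow> (int \<Rightarrow> 'a \<Rightarrow> 'a) \<Rightarrow> bool" where
  "contraction K X d Y e f g h \<longleftrightarrow>
     chain_map K X d Y e f \<and> chain_map K Y e X d g \<and>
     (\<forall>n. linear_map K (X n) (X (n + 1)) (h n)) \<and>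
     (\<forall>n. \<forall>y\<in>carrier (Y n). f n (g n y) = y) \<and>
     (\<forall>n. \<forall>x\<in>carrier (X n).
        g n (f n x) = x \<oplus>\<^bsub>X n\<^esub> d (n + 1) (h n x) \<oplus>\<^bsub>X n\<^esub> h (n - 1) (d n x)) \<and>
     (\<forall>n. \<forall>x\<in>carrier (X n). f (n + 1) (h n x) = \<zero>\<^bsub>Y (n + 1)\<^esub>) \<and>
     (\<forall>n. \<forall>y\<in>carrier (Y n). h n (g n y) = \<zero>\<^bsub>X (n + 1)\<^esub>) \<and>
     (\<forall>n. \<forall>x\<in>carrier (X n). h (n + 1) (h n x) = \<zero>\<^bsub>X (n + 2)\<^esub>)"


section \<open>Graded complexes and Conley complexes\<close>

abbreviation total :: "(int \<Rightarrow> 'p \<Rightarrow> ('k, 'a) module) \<Rightarrow> int \<Rightarrow> ('k, 'p \<Rightarrow> 'a) module" where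
  "total C \<equiv> \<lambda>n. dsum (C n)"

definition graded_complex ::
    "('k, 'r) ring_scheme \<Rightarrow> (int \<Rightarrow> 'p::order \<Rightarrow> ('k, 'a) module) \<Rightarrow>
     (int \<Rightarrow> ('p \<Rightarrow> 'a) \<Rightarrow> 'p \<Rightarrow> 'a) \<Rightarrow> bool" where
  "graded_complex K C d \<longleftrightarrow>
     (\<forall>n p. vectorspace K (C n p)) \<and>
     chain_complex K (total C) d \<and>
     (\<forall>n. filtered (C n) (C (n - 1)) (d n))"

text \<open>\<open>relative C p\<close> and \<open>rel_diff C d p\<close> form the relative chain complex $(C^p, t^p)$.\<close>

definition relative :: "(int \<Rightarrow> 'p \<Rightarrow> ('k, 'a) module) \<Rightarrow> 'p \<Rightarrow> int \<Rightarrow> ('k, 'a) module" where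
  "relative C p n = C n p"

definition rel_diff ::
    "(int \<Rightarrow> 'p \<Rightarrow> ('k, 'a) module) \<Rightarrow> (int \<Rightarrow> ('p \<Rightarrow> 'a) \<Rightarrow> 'p \<Rightarrow> 'a) \<Rightarrow> 'p \<Rightarrow> int \<Rightarrow> 'a \<Rightarrow> 'a" where
  "rel_diff C d p n = component (C n) (d n) p p"

definition strict ::
    "(int \<Rightarrow> 'p \<Rightarrow> ('k, 'a) module) \<Rightarrow> (int \<Rightarrow> ('p \<Rightarrow> 'a) \<Rightarrow> 'p \<Rightarrow> 'a) \<Rightarrow> bool" where
  "strict C d \<longleftrightarrow> (\<forall>p n. \<forall>v\<in>carrier (C n p). rel_diff C d p n v = \<zero>\<^bsub>C (n - 1) p\<^esub>)"

definition filtered_homotopy_equivalence ::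
    "('k, 'r) ring_scheme \<Rightarrow>
     (int \<Rightarrow> 'p::order \<Rightarrow> ('k, 'a) module) \<Rightarrow> (int \<Rightarrow> ('p \<Rightarrow> 'a) \<Rightarrow> 'p \<Rightarrow> 'a) \<Rightarrow>
     (int \<Rightarrow> 'p \<Rightarrow> ('k, 'b) module) \<Rightarrow> (int \<Rightarrow> ('p \<Rightarrow> 'b) \<Rightarrow> 'p \<Rightarrow> 'b) \<Rightarrow>
     (int \<Rightarrow> ('p \<Rightarrow> 'a) \<Rightarrow> 'p \<Rightarrow> 'b) \<Rightarrow> (int \<Rightarrow> ('p \<Rightarrow> 'b) \<Rightarrow> 'p \<Rightarrow> 'a) \<Rightarrow>
     (int \<Rightarrow> ('p \<Rightarrow> 'a) \<Rightarrow> 'p \<Rightarrow> 'a) \<Rightarrow> (int \<Rightarrow> ('p \<Rightarrow> 'b) \<Rightarrow> 'p \<Rightarrow> 'b) \<Rightarrow> bool" where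
  "filtered_homotopy_equivalence K C d C' d' f g h k \<longleftrightarrow>
     homotopy_equivalence K (total C) d (total C') d' f g h k \<and>
     (\<forall>n. filtered (C n) (C' n) (f n)) \<and> (\<forall>n. filtered (C' n) (C n) (g n)) \<and>
     (\<forall>n. filtered (C n) (C (n + 1)) (h n)) \<and> (\<forall>n. filtered (C' n) (C' (n + 1)) (k n))"

definition filtered_contraction ::
    "('k, 'r) ring_scheme \<Rightarrow>
     (int \<Rightarrow> 'p::order \<Rightarrow> ('k, 'a) module) \<Rightarrow> (int \<Rightarrow> ('p \<Rightarrow> 'a) \<Rightarrow> 'p \<Rightarrow> 'a) \<Rightarrow>
     (int \<Rightarrow> 'p \<Rightarrow> ('k, 'b) module) \<Rightarrow> (int \<Rightarrow> ('p \<Rightarrow> 'b) \<Rightarrow> 'p \<Rightarrow> 'b) \<Rightarrow>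
     (int \<Rightarrow> ('p \<Rightarrow> 'a) \<Rightarrow> 'p \<Rightarrow> 'b) \<Rightarrow> (int \<Rightarrow> ('p \<Rightarrow> 'b) \<Rightarrow> 'p \<Rightarrow> 'a) \<Rightarrow>
     (int \<Rightarrow> ('p \<Rightarrow> 'a) \<Rightarrow> 'p \<Rightarrow> 'a) \<Rightarrow> bool" where
  "filtered_contraction K C d C' d' f g h \<longleftrightarrow>
     contraction K (total C) d (total C') d' f g h \<and>
     (\<forall>n. filtered (C n) (C' n) (f n)) \<and> (\<forall>n. filtered (C' n) (C n) (g n)) \<and>
     (\<forall>n. filtered (C n) (C (n + 1)) (h n))"

definition conley_complex ::
    "('k, 'r) ring_scheme \<Rightarrow>
     (int \<Rightarrow> 'p::order \<Rightarrow> ('k, 'a) module) \<Rightarrow> (int \<Rightarrow> ('p \<Rightarrow> 'a) \<Rightarrow> 'p \<Rightarrow> 'a) \<Rightarrow>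
     (int \<Rightarrow> 'p \<Rightarrow> ('k, 'b) module) \<Rightarrow> (int \<Rightarrow> ('p \<Rightarrow> 'b) \<Rightarrow> 'p \<Rightarrow> 'b) \<Rightarrow> bool" where
  "conley_complex K C d C' d' \<longleftrightarrow>
     graded_complex K C' d' \<and>
     (\<exists>f g h k. filtered_homotopy_equivalence K C d C' d' f g h k) \<and>
     strict C' d'"


section \<open>Homology and homology decompositions\<close>

text \<open>The space of cosets of a subspace \<open>W\<close>; cf. \<^const>\<open>FactRing\<close> for quotient rings.\<close>

definition quotient_space :: "('k, 'a) module \<Rightarrow> 'a set \<Rightarrow> ('k, 'a set) module" where
  "quotient_space V W =
     \<lparr>carrier = a_rcosets\<^bsub>V\<^esub> W,
      mult = (\<lambda>X Y. W),
      one = W,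
      zero = W,
      add = set_add V,
      smult = (\<lambda>c X. \<Union>x\<in>X. W +>\<^bsub>V\<^esub> (c \<odot>\<^bsub>V\<^esub> x))\<rparr>"

lemma quotient_space_vectorspace:
  assumes V: "vectorspace K V" and W: "submodule K W V"
  shows "vectorspace K (quotient_space V W)"
proof -
  interpret V: vectorspace K V by (fact V)
  have WM: "W \<subseteq> carrier V" using W by (simp add: submodule_def)
  interpret S: subgroup W "add_monoid V"
  proof (rule V.M.add.subgroupI)
    show "W \<noteq> {}" using submodule.zero_closed[OF W] by auto
    fix a assume a: "a \<in> W"
    have "(\<ominus>\<^bsub>K\<^esub> \<one>\<^bsub>K\<^esub>) \<odot>\<^bsub>V\<^esub> a \<in> W" using submodule.smult_closed[OF W] a by simp
    also have "(\<ominus>\<^bsub>K\<^esub> \<one>\<^bsub>K\<^esub>) \<odot>\<^bsub>V\<^esub> a = \<ominus>\<^bsub>V\<^esub> a" using a WM V.smult_l_minus[of "\<one>\<^bsub>K\<^esub>" a] by auto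
    finally show "\<ominus>\<^bsub>V\<^esub> a \<in> W" .
  qed (use WM submodule.m_closed[OF W] in auto)
  have "abelian_subgroup W V"
    by (intro abelian_subgroupI3 V.M.abelian_group_axioms) (simp add: additive_subgroup_def S.subgroup_axioms)
  interpret W: abelian_subgroup W V by fact
  note rs = W.a_rcos_sum
  have car: "X \<in> carrier (quotient_space V W) \<longleftrightarrow> (\<exists>x\<in>carrier V. X = W +>\<^bsub>V\<^esub> x)" for X
    by (auto simp: quotient_space_def A_RCOSETS_def' a_r_coset_def)
  have add: "(W +>\<^bsub>V\<^esub> x) \<oplus>\<^bsub>quotient_space V W\<^esub> (W +>\<^bsub>V\<^esub> y) = W +>\<^bsub>V\<^esub> (x \<oplus>\<^bsub>V\<^esub> y)"
    if "x \<in> carrier V" "y \<in> carrier V" for x y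
    using that by (simp add: quotient_space_def rs)
  have zero: "\<zero>\<^bsub>quotient_space V W\<^esub> = W +>\<^bsub>V\<^esub> \<zero>\<^bsub>V\<^esub>"
    using WM by (simp add: quotient_space_def V.M.a_coset_add_zero)
  have sm: "c \<odot>\<^bsub>quotient_space V W\<^esub> (W +>\<^bsub>V\<^esub> x) = W +>\<^bsub>V\<^esub> (c \<odot>\<^bsub>V\<^esub> x)"
    if "x \<in> carrier V" "c \<in> carrier K" for c x
  proof -
    have *: "W +>\<^bsub>V\<^esub> (c \<odot>\<^bsub>V\<^esub> y) = W +>\<^bsub>V\<^esub> (c \<odot>\<^bsub>V\<^esub> x)" if "y \<in> W +>\<^bsub>V\<^esub> x" for y
    proof -
      from that obtain w where w: "w \<in> W" "y = w \<oplus>\<^bsub>V\<^esub> x" by (auto simp: a_r_coset_def')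
      then have "c \<odot>\<^bsub>V\<^esub> y = c \<odot>\<^bsub>V\<^esub> w \<oplus>\<^bsub>V\<^esub> c \<odot>\<^bsub>V\<^esub> x" using \<open>x \<in> _\<close> \<open>c \<in> _\<close> WM
        by (auto simp: V.smult_r_distr)
      then have "c \<odot>\<^bsub>V\<^esub> y \<in> W +>\<^bsub>V\<^esub> (c \<odot>\<^bsub>V\<^esub> x)"
        using submodule.smult_closed[OF W \<open>c \<in> _\<close> w(1)] by (auto simp: a_r_coset_def')
      then show ?thesis
        using V.M.add.repr_independence[OF _ _ S.subgroup_axioms] \<open>x \<in> _\<close> \<open>c \<in> _\<close>
        unfolding a_r_coset_def by simp
    qed
    have "(\<Union>y\<in>W +>\<^bsub>V\<^esub> x. W +>\<^bsub>V\<^esub> (c \<odot>\<^bsub>V\<^esub> y)) = (\<Union>y\<in>W +>\<^bsub>V\<^esub> x. W +>\<^bsub>V\<^esub> (c \<odot>\<^bsub>V\<^esub> x))"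
      by (rule SUP_cong[OF refl *])
    also have "\<dots> = W +>\<^bsub>V\<^esub> (c \<odot>\<^bsub>V\<^esub> x)"
      using W.a_rcos_self[OF that(1)] by blast
    finally show ?thesis unfolding quotient_space_def by simp
  qed
  have inv: "\<exists>Y\<in>carrier (quotient_space V W). Y \<oplus>\<^bsub>quotient_space V W\<^esub> X = \<zero>\<^bsub>quotient_space V W\<^esub>"
    if "X \<in> carrier (quotient_space V W)" for X
  proof -
    from that obtain x where x: "x \<in> carrier V" "X = W +>\<^bsub>V\<^esub> x" by (auto simp: car)
    then have "(W +>\<^bsub>V\<^esub> (\<ominus>\<^bsub>V\<^esub> x)) \<oplus>\<^bsub>quotient_space V W\<^esub> X = \<zero>\<^bsub>quotient_space V W\<^esub>"
      by (simp add: add zero V.M.l_neg)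
    then show ?thesis using x car by blast
  qed
  have "abelian_group (quotient_space V W)"
  proof (rule abelian_groupI)
    fix X Y assume "X \<in> carrier (quotient_space V W)" "Y \<in> carrier (quotient_space V W)"
    then show "X \<oplus>\<^bsub>quotient_space V W\<^esub> Y = Y \<oplus>\<^bsub>quotient_space V W\<^esub> X"
      by (auto simp: car add V.M.a_comm)
  qed (use inv in \<open>auto simp: car add zero V.M.a_assoc\<close>)
  then have "module K (quotient_space V W)"
    by (intro moduleI V.R.is_cring)
      (auto simp: car add zero sm V.smult_l_distr V.smult_r_distr V.smult_assoc1)
  then show ?thesis
    by (intro vectorspace.intro) (auto intro: V.field_axioms)
qed

definition boundaries :: "(int \<Rightarrow> ('k, 'a) module) \<Rightarrow> (int \<Rightarrow> 'a \<Rightarrow> 'a) \<Rightarrow> int \<Rightarrow> 'a set" where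
  "boundaries X t n = t (n + 1) ` carrier (X (n + 1))"

definition boundary_space ::
    "(int \<Rightarrow> ('k, 'a) module) \<Rightarrow> (int \<Rightarrow> 'a \<Rightarrow> 'a) \<Rightarrow> int \<Rightarrow> ('k, 'a) module" where
  "boundary_space X t n = (X n)\<lparr>carrier := boundaries X t n\<rparr>"

definition homology ::
    "(int \<Rightarrow> ('k, 'a) module) \<Rightarrow> (int \<Rightarrow> 'a \<Rightarrow> 'a) \<Rightarrow> int \<Rightarrow> ('k, 'a set) module" where
  "homology X t n =
     quotient_space ((X n)\<lparr>carrier := a_kernel (X n) (X (n - 1)) (t n)\<rparr>) (boundaries X t n)"

text \<open>The target $H_n \oplus B_n \oplus K_n$ of the decomposition, where $K_n = B_{n-1}$.\<close>

definition decomposed ::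
    "(int \<Rightarrow> ('k, 'a) module) \<Rightarrow> (int \<Rightarrow> 'a \<Rightarrow> 'a) \<Rightarrow> int \<Rightarrow> ('k, 'a set \<times> 'a \<times> 'a) module" where
  "decomposed X t n =
     direct_sum (homology X t n) (direct_sum (boundary_space X t n) (boundary_space X t (n - 1)))"

abbreviation zeta_inv ::
    "(int \<Rightarrow> ('k, 'a) module) \<Rightarrow> (int \<Rightarrow> 'a \<Rightarrow> 'a set \<times> 'a \<times> 'a) \<Rightarrow> int \<Rightarrow> 'a set \<times> 'a \<times> 'a \<Rightarrow> 'a" where
  "zeta_inv X \<zeta> n \<equiv> inv_into (carrier (X n)) (\<zeta> n)"

definition homology_decomposition ::
    "('k, 'r) ring_scheme \<Rightarrow> (int \<Rightarrow> ('k, 'a) module) \<Rightarrow> (int \<Rightarrow> 'a \<Rightarrow> 'a) \<Rightarrow>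
     (int \<Rightarrow> 'a \<Rightarrow> 'a set \<times> 'a \<times> 'a) \<Rightarrow> bool" where
  "homology_decomposition K X t \<zeta> \<longleftrightarrow>
     (\<forall>n. linear_map K (X n) (decomposed X t n) (\<zeta> n) \<and>
          bij_betw (\<zeta> n) (carrier (X n)) (carrier (decomposed X t n))) \<and>
     (\<forall>n. \<forall>(h, b, k)\<in>carrier (decomposed X t n).
        \<zeta> (n - 1) (t n (zeta_inv X \<zeta> n (h, b, k)))
          = (\<zero>\<^bsub>homology X t (n - 1)\<^esub>, k, \<zero>\<^bsub>boundary_space X t (n - 2)\<^esub>))"

definition alpha_at :: "(int \<Rightarrow> 'a \<Rightarrow> 'a set \<times> 'a \<times> 'a) \<Rightarrow> int \<Rightarrow> 'a \<Rightarrow> 'a set" where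
  "alpha_at \<zeta> n v = fst (\<zeta> n v)"

definition beta_at ::
    "(int \<Rightarrow> ('k, 'a) module) \<Rightarrow> (int \<Rightarrow> 'a \<Rightarrow> 'a) \<Rightarrow> (int \<Rightarrow> 'a \<Rightarrow> 'a set \<times> 'a \<times> 'a) \<Rightarrow>
     int \<Rightarrow> 'a set \<Rightarrow> 'a" where
  "beta_at X t \<zeta> n h =
     zeta_inv X \<zeta> n (h, \<zero>\<^bsub>boundary_space X t n\<^esub>, \<zero>\<^bsub>boundary_space X t (n - 1)\<^esub>)"

definition gamma_at ::
    "(int \<Rightarrow> ('k, 'a) module) \<Rightarrow> (int \<Rightarrow> 'a \<Rightarrow> 'a) \<Rightarrow> (int \<Rightarrow> 'a \<Rightarrow> 'a set \<times> 'a \<times> 'a) \<Rightarrow>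
     int \<Rightarrow> 'a \<Rightarrow> 'a" where
  "gamma_at X t \<zeta> n v =
     \<ominus>\<^bsub>X (n + 1)\<^esub> zeta_inv X \<zeta> (n + 1)
       (\<zero>\<^bsub>homology X t (n + 1)\<^esub>, \<zero>\<^bsub>boundary_space X t (n + 1)\<^esub>, fst (snd (\<zeta> n v)))"


section \<open>The perturbation construction\<close>

text \<open>
  \<open>C\<close> and \<open>d\<close> are the graded complex and \<open>\<zeta> p\<close> is the decomposition of the relative complex at \<open>p\<close>.
  Degrees: \<open>\<alpha>\<close>, \<open>\<beta>\<close> have degree 0, \<open>\<gamma>\<close> degree 1, \<open>\<delta>\<close> and \<open>\<S>\<close> degree -1; the integer argument
  is always the degree of the source.
\<close>

locale perturbation_data =
  fixes C :: "int \<Rightarrow> 'p::order \<Rightarrow> ('k, 'a) module"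
    and d :: "int \<Rightarrow> ('p \<Rightarrow> 'a) \<Rightarrow> 'p \<Rightarrow> 'a"
    and \<zeta> :: "'p \<Rightarrow> int \<Rightarrow> 'a \<Rightarrow> 'a set \<times> 'a \<times> 'a"
begin

definition Cbar :: "int \<Rightarrow> 'p \<Rightarrow> ('k, 'a set) module" where
  "Cbar n p = homology (relative C p) (rel_diff C d p) n"

definition \<alpha> :: "int \<Rightarrow> ('p \<Rightarrow> 'a) \<Rightarrow> 'p \<Rightarrow> 'a set" where
  "\<alpha> n = graded_sum (C n) (Cbar n) (\<lambda>p. alpha_at (\<zeta> p) n)"

definition \<beta> :: "int \<Rightarrow> ('p \<Rightarrow> 'a set) \<Rightarrow> 'p \<Rightarrow> 'a" where
  "\<beta> n = graded_sum (Cbar n) (C n) (\<lambda>p. beta_at (relative C p) (rel_diff C d p) (\<zeta> p) n)"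

definition \<gamma> :: "int \<Rightarrow> ('p \<Rightarrow> 'a) \<Rightarrow> 'p \<Rightarrow> 'a" where
  "\<gamma> n = graded_sum (C n) (C (n + 1))
           (\<lambda>p. gamma_at (relative C p) (rel_diff C d p) (\<zeta> p) n)"

definition d_hat :: "int \<Rightarrow> ('p \<Rightarrow> 'a) \<Rightarrow> 'p \<Rightarrow> 'a" where
  "d_hat n = graded_sum (C n) (C (n - 1)) (\<lambda>p. rel_diff C d p n)"

definition \<delta> :: "int \<Rightarrow> ('p \<Rightarrow> 'a) \<Rightarrow> 'p \<Rightarrow> 'a" where
  "\<delta> n x = d n x \<ominus>\<^bsub>dsum (C (n - 1))\<^esub> d_hat n x"

definition \<gamma>\<delta> :: "int \<Rightarrow> ('p \<Rightarrow> 'a) \<Rightarrow> 'p \<Rightarrow> 'a" where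
  "\<gamma>\<delta> n x = \<gamma> (n - 1) (\<delta> n x)"

definition one_minus_\<gamma>\<delta> :: "int \<Rightarrow> ('p \<Rightarrow> 'a) \<Rightarrow> 'p \<Rightarrow> 'a" where
  "one_minus_\<gamma>\<delta> n x = x \<ominus>\<^bsub>dsum (C n)\<^esub> \<gamma>\<delta> n x"

definition \<S> :: "int \<Rightarrow> ('p \<Rightarrow> 'a) \<Rightarrow> 'p \<Rightarrow> 'a" where
  "\<S> n x = \<delta> n (inv_into (carrier (dsum (C n))) (one_minus_\<gamma>\<delta> n) x)"

definition dbar :: "int \<Rightarrow> ('p \<Rightarrow> 'a set) \<Rightarrow> 'p \<Rightarrow> 'a set" where
  "dbar n y = \<alpha> (n - 1) (\<S> n (\<beta> n y))"

definition \<alpha>bar :: "int \<Rightarrow> ('p \<Rightarrow> 'a) \<Rightarrow> 'p \<Rightarrow> 'a set" where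
  "\<alpha>bar n x = \<alpha> n x \<oplus>\<^bsub>dsum (Cbar n)\<^esub> \<alpha> n (\<S> (n + 1) (\<gamma> n x))"

definition \<beta>bar :: "int \<Rightarrow> ('p \<Rightarrow> 'a set) \<Rightarrow> 'p \<Rightarrow> 'a" where
  "\<beta>bar n y = \<beta> n y \<oplus>\<^bsub>dsum (C n)\<^esub> \<gamma> (n - 1) (\<S> n (\<beta> n y))"

definition \<gamma>bar :: "int \<Rightarrow> ('p \<Rightarrow> 'a) \<Rightarrow> 'p \<Rightarrow> 'a" where
  "\<gamma>bar n x = \<gamma> n x \<oplus>\<^bsub>dsum (C (n + 1))\<^esub> \<gamma> n (\<S> (n + 1) (\<gamma> n x))"

text \<open>\<open>1 - \<gamma>\<delta>\<close> is invertible and $\mathcal S = \sum_{i\ge0} \delta(\gamma\delta)^i$ as a pointwise finite sum.\<close>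

definition inverse_exists :: bool where
  "inverse_exists \<longleftrightarrow>
     (\<forall>n. bij_betw (one_minus_\<gamma>\<delta> n) (carrier (dsum (C n))) (carrier (dsum (C n))))"

definition \<S>_is_series :: bool where
  "\<S>_is_series \<longleftrightarrow>
     (\<forall>n. \<forall>x\<in>carrier (dsum (C n)).
        finite {i. \<delta> n ((\<gamma>\<delta> n ^^ i) x) \<noteq> \<zero>\<^bsub>dsum (C (n - 1))\<^esub>} \<and>
        \<S> n x = (\<Oplus>\<^bsub>dsum (C (n - 1))\<^esub>
                   i\<in>{i. \<delta> n ((\<gamma>\<delta> n ^^ i) x) \<noteq> \<zero>\<^bsub>dsum (C (n - 1))\<^esub>}. \<delta> n ((\<gamma>\<delta> n ^^ i) x)))"

end

end

theory Submission
  imports Defs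
begin

text \<open>
  The theorem is an instance of homological perturbation. Split \<open>d\<close> as \<open>d_hat + \<delta>\<close>, where
  \<open>d_hat\<close> collects the diagonal entries \<open>t\<^sup>p\<close> and \<open>\<delta>\<close> strictly lowers the grading. By the homology decomposition each
  relative complex is \<open>H \<oplus> B \<oplus> K\<close> with differential \<open>(h, b, k) \<mapsto> (0, k, 0)\<close>, so it contracts onto its
  homology by \<open>\<alpha>(h, b, k) = h\<close>, \<open>\<beta> h = (h, 0, 0)\<close> and \<open>\<gamma>(h, b, k) = (0, 0, -b)\<close>. Summed over \<open>P\<close>, these
  contract \<open>(C, d_hat)\<close> onto \<open>Cbar\<close> with zero differential, and adding \<open>\<delta>\<close> to \<open>d_hat\<close> deforms
  this contraction.

  The deformation needs the inverse \<open>A\<close> of \<open>1 - \<gamma>\<delta>\<close>. Since \<open>\<gamma>\<close> preserves the grading, \<open>\<gamma>\<delta>\<close> maps a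
  summand \<open>C\<^sup>q\<close> into the sum of the \<open>C\<^sup>p\<close> with \<open>p < q\<close>. An element meets only finitely many summands, so
  well-founded induction on \<open>q\<close> shows that every element is killed by some power of \<open>\<gamma>\<delta>\<close>
  (\<open>locally_nilpotent_if_lowering\<close>). The geometric series is therefore pointwise finite and inverts
  \<open>1 - \<gamma>\<delta>\<close> (\<open>locally_nilpotent\<close>), although no single power of \<open>\<gamma>\<delta>\<close> need vanish.

  The algebra (locale \<open>perturbation\<close>) rests on the forms \<open>\<beta>bar = A\<beta>\<close>, \<open>\<gamma>bar = A\<gamma>\<close> and
  \<open>\<alpha>bar = \<alpha>A'\<close>, where \<open>A' = 1 + S\<gamma>\<close> is the inverse of \<open>1 - \<delta>\<gamma>\<close>. To prove an equation whose one side is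
  \<open>A z\<close>, it suffices that the other side \<open>x\<close> satisfies \<open>x = z + \<gamma>\<delta>x\<close>; likewise an argument \<open>x\<close> of \<open>A'\<close> is
  replaced by \<open>w = A'x\<close>, for which \<open>w = x + \<delta>\<gamma>w\<close>. In this way the two chain map equations and
  \<open>\<beta>bar \<alpha>bar = 1 + d \<gamma>bar + \<gamma>bar d\<close> reduce to
  \<open>d_hat \<delta> + \<delta> d_hat + \<delta>\<delta> = 0\<close>, and they are written without subtraction, so that they are
  settled by commutativity and associativity.

  Finally every map involved sends the summand at \<open>q\<close> into the elements supported on \<open>{..q}\<close>, which
  is what being filtered means, and the factor \<open>\<delta>\<close> in \<open>dbar = \<alpha>\<delta>A\<beta>\<close> moves it into \<open>{..<q}\<close>, which makes
  \<open>dbar\<close> strict.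
\<close>

section \<open>Linear maps\<close>

lemma linear_mapI:
  assumes "vectorspace K V" "vectorspace K W"
    and "\<And>x. x \<in> carrier V \<Longrightarrow> f x \<in> carrier W"
    and "\<And>x y. x \<in> carrier V \<Longrightarrow> y \<in> carrier V \<Longrightarrow> f (x \<oplus>\<^bsub>V\<^esub> y) = f x \<oplus>\<^bsub>W\<^esub> f y"
    and "\<And>c x. c \<in> carrier K \<Longrightarrow> x \<in> carrier V \<Longrightarrow> f (c \<odot>\<^bsub>V\<^esub> x) = c \<odot>\<^bsub>W\<^esub> f x"
  shows "linear_map K V W f"
  using assms
  by (auto simp: linear_map_def mod_hom_def mod_hom_axioms_def module_hom_def vectorspace_def)

lemma linear_mapD:
  assumes "linear_map K V W f"
  shows linear_map_source: "vectorspace K V" and linear_map_target: "vectorspace K W"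
    and linear_map_closed: "x \<in> carrier V \<Longrightarrow> f x \<in> carrier W"
    and linear_map_add: "x \<in> carrier V \<Longrightarrow> y \<in> carrier V \<Longrightarrow> f (x \<oplus>\<^bsub>V\<^esub> y) = f x \<oplus>\<^bsub>W\<^esub> f y"
    and linear_map_smult: "c \<in> carrier K \<Longrightarrow> x \<in> carrier V \<Longrightarrow> f (c \<odot>\<^bsub>V\<^esub> x) = c \<odot>\<^bsub>W\<^esub> f x"
    and linear_map_zero: "f \<zero>\<^bsub>V\<^esub> = \<zero>\<^bsub>W\<^esub>"
    and linear_map_neg: "x \<in> carrier V \<Longrightarrow> f (\<ominus>\<^bsub>V\<^esub> x) = \<ominus>\<^bsub>W\<^esub> f x"
    and linear_map_diff: "x \<in> carrier V \<Longrightarrow> y \<in> carrier V \<Longrightarrow> f (x \<ominus>\<^bsub>V\<^esub> y) = f x \<ominus>\<^bsub>W\<^esub> f y"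
proof -
  interpret linear_map K V W f by fact
  show "vectorspace K V" "vectorspace K W" by unfold_locales
qed (use assms linear_map.axioms(3)[OF assms] in \<open>auto simp: mod_hom.f_im mod_hom.f0_is_0
       mod_hom.f_neg mod_hom.f_minus module_hom_add module_hom_smult dest: mod_hom.f_hom\<close>)

lemma linear_map_comp:
  assumes "linear_map K U V f" "linear_map K V W g"
  shows "linear_map K U W (\<lambda>x. g (f x))"
  by (rule linear_mapI)
    (use assms in \<open>auto simp: linear_mapD(3,4,5) intro: linear_mapD\<close>)

lemma linear_map_sum:
  assumes f: "linear_map K V W f" and g: "linear_map K V W g"
  shows "linear_map K V W (\<lambda>x. f x \<oplus>\<^bsub>W\<^esub> g x)"
proof -
  interpret W: vectorspace K W using f by (rule linear_mapD)
  show ?thesis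
    by (rule linear_mapI) (use assms in \<open>auto simp: linear_mapD(3,4,5)[OF f] linear_mapD(3,4,5)[OF g]
       W.a_ac W.smult_r_distr intro: linear_mapD\<close>)
qed

lemma linear_map_uminus:
  assumes f: "linear_map K V W f"
  shows "linear_map K V W (\<lambda>x. \<ominus>\<^bsub>W\<^esub> f x)"
proof -
  interpret W: vectorspace K W using f by (rule linear_mapD)
  show ?thesis
    by (rule linear_mapI) (use assms in \<open>auto simp: linear_mapD(3,4,5)[OF f]
       W.minus_add W.smult_r_minus intro: linear_mapD\<close>)
qed


section \<open>The perturbation lemma\<close>

text \<open>
  The maps \<open>\<alpha>\<close>, \<open>\<beta>\<close>, \<open>\<gamma>\<close> contract \<open>(X, dh)\<close> onto \<open>Y\<close> with zero differential, which is what
  \<open>dh_\<beta>\<close> and \<open>\<alpha>_dh\<close> express, and \<open>d = dh + \<delta>\<close> is again a differential. The last three assumptions say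
  that \<open>A\<close> inverts \<open>1 - \<gamma>\<delta>\<close>. In this fixed-point form no subtraction occurs, and
  \<open>A_unique\<close> is the tool for proving equations between values of \<open>A\<close>.
\<close>

locale perturbation =
  fixes K :: "('k, 'r) ring_scheme"
    and X :: "int \<Rightarrow> ('k, 'a) module" and Y :: "int \<Rightarrow> ('k, 'b) module"
    and d dh \<delta> :: "int \<Rightarrow> 'a \<Rightarrow> 'a"
    and \<alpha> :: "int \<Rightarrow> 'a \<Rightarrow> 'b" and \<beta> :: "int \<Rightarrow> 'b \<Rightarrow> 'a" and \<gamma> :: "int \<Rightarrow> 'a \<Rightarrow> 'a"
    and A :: "int \<Rightarrow> 'a \<Rightarrow> 'a"
  assumes dh_lin: "linear_map K (X n) (X (n - 1)) (dh n)"
    and \<delta>_lin: "linear_map K (X n) (X (n - 1)) (\<delta> n)"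
    and \<alpha>_lin: "linear_map K (X n) (Y n) (\<alpha> n)"
    and \<beta>_lin: "linear_map K (Y n) (X n) (\<beta> n)"
    and \<gamma>_lin: "linear_map K (X n) (X (n + 1)) (\<gamma> n)"
    and complex: "chain_complex K X d"
    and d_eq: "x \<in> carrier (X n) \<Longrightarrow> d n x = dh n x \<oplus>\<^bsub>X (n - 1)\<^esub> \<delta> n x"
    and dh_dh: "x \<in> carrier (X n) \<Longrightarrow> dh (n - 1) (dh n x) = \<zero>\<^bsub>X (n - 2)\<^esub>"
    and dh_\<beta>: "y \<in> carrier (Y n) \<Longrightarrow> dh n (\<beta> n y) = \<zero>\<^bsub>X (n - 1)\<^esub>"
    and \<alpha>_dh: "x \<in> carrier (X n) \<Longrightarrow> \<alpha> (n - 1) (dh n x) = \<zero>\<^bsub>Y (n - 1)\<^esub>"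
    and \<alpha>_\<beta>: "y \<in> carrier (Y n) \<Longrightarrow> \<alpha> n (\<beta> n y) = y"
    and \<beta>_\<alpha>: "x \<in> carrier (X n) \<Longrightarrow>
           \<beta> n (\<alpha> n x) = x \<oplus>\<^bsub>X n\<^esub> dh (n + 1) (\<gamma> n x) \<oplus>\<^bsub>X n\<^esub> \<gamma> (n - 1) (dh n x)"
    and \<alpha>_\<gamma>: "x \<in> carrier (X n) \<Longrightarrow> \<alpha> (n + 1) (\<gamma> n x) = \<zero>\<^bsub>Y (n + 1)\<^esub>"
    and \<gamma>_\<beta>: "y \<in> carrier (Y n) \<Longrightarrow> \<gamma> n (\<beta> n y) = \<zero>\<^bsub>X (n + 1)\<^esub>"
    and \<gamma>_\<gamma>: "x \<in> carrier (X n) \<Longrightarrow> \<gamma> (n + 1) (\<gamma> n x) = \<zero>\<^bsub>X (n + 2)\<^esub>"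
    and A_closed: "x \<in> carrier (X n) \<Longrightarrow> A n x \<in> carrier (X n)"
    and A_fix: "x \<in> carrier (X n) \<Longrightarrow> A n x = x \<oplus>\<^bsub>X n\<^esub> \<gamma> (n - 1) (\<delta> n (A n x))"
    and A_unique: "x \<in> carrier (X n) \<Longrightarrow> x' \<in> carrier (X n) \<Longrightarrow>
           x' = x \<oplus>\<^bsub>X n\<^esub> \<gamma> (n - 1) (\<delta> n x') \<Longrightarrow> A n x = x'"
begin

sublocale X: vectorspace K "X n" for n
  using \<alpha>_lin by (rule linear_mapD)

sublocale Y: vectorspace K "Y n" for n
  using \<alpha>_lin by (rule linear_mapD)

lemma degree_shift [simp]: "1 + n = n + 1" "2 + n = n + 2" for n :: int
  by auto

text \<open>
  In the following rules degrees are matched through side conditions such as \<open>m = n - 1\<close>: the simplifier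
  turns \<open>n - 1 + 1\<close> into \<open>n\<close>, and a rule whose left-hand side contains \<open>n + 1\<close> would miss that instance.
\<close>

lemma maps_closed [simp]:
  shows "x \<in> carrier (X n) \<Longrightarrow> m = n - 1 \<Longrightarrow> d n x \<in> carrier (X m)"
    and "x \<in> carrier (X n) \<Longrightarrow> m = n - 1 \<Longrightarrow> dh n x \<in> carrier (X m)"
    and "x \<in> carrier (X n) \<Longrightarrow> m = n - 1 \<Longrightarrow> \<delta> n x \<in> carrier (X m)"
    and "x \<in> carrier (X n) \<Longrightarrow> \<alpha> n x \<in> carrier (Y n)"
    and "y \<in> carrier (Y n) \<Longrightarrow> \<beta> n y \<in> carrier (X n)"
    and "x \<in> carrier (X n) \<Longrightarrow> m = n + 1 \<Longrightarrow> \<gamma> n x \<in> carrier (X m)"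
    and "x \<in> carrier (X n) \<Longrightarrow> A n x \<in> carrier (X n)"
  using complex
  by (auto simp: chain_complex_def linear_map_closed[OF dh_lin] linear_map_closed[OF \<delta>_lin]
      linear_map_closed[OF \<alpha>_lin] linear_map_closed[OF \<beta>_lin] linear_map_closed[OF \<gamma>_lin] A_closed
      intro: linear_mapD)

lemma maps_add [simp]:
  assumes "x \<in> carrier (X n)" "y \<in> carrier (X n)"
  shows "m = n - 1 \<Longrightarrow> dh n (x \<oplus>\<^bsub>X n\<^esub> y) = dh n x \<oplus>\<^bsub>X m\<^esub> dh n y"
    and "m = n - 1 \<Longrightarrow> \<delta> n (x \<oplus>\<^bsub>X n\<^esub> y) = \<delta> n x \<oplus>\<^bsub>X m\<^esub> \<delta> n y"
    and "\<alpha> n (x \<oplus>\<^bsub>X n\<^esub> y) = \<alpha> n x \<oplus>\<^bsub>Y n\<^esub> \<alpha> n y"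
    and "m = n + 1 \<Longrightarrow> \<gamma> n (x \<oplus>\<^bsub>X n\<^esub> y) = \<gamma> n x \<oplus>\<^bsub>X m\<^esub> \<gamma> n y"
  using assms by (auto simp: linear_map_add[OF dh_lin] linear_map_add[OF \<delta>_lin]
      linear_map_add[OF \<alpha>_lin] linear_map_add[OF \<gamma>_lin])

lemma d_lin: "linear_map K (X n) (X (n - 1)) (d n)"
  using complex by (simp add: chain_complex_def)

lemma maps_zero [simp]:
  shows "m = n \<Longrightarrow> dh n \<zero>\<^bsub>X m\<^esub> = \<zero>\<^bsub>X (n - 1)\<^esub>"
    and "m = n \<Longrightarrow> \<delta> n \<zero>\<^bsub>X m\<^esub> = \<zero>\<^bsub>X (n - 1)\<^esub>"
    and "m = n \<Longrightarrow> \<alpha> n \<zero>\<^bsub>X m\<^esub> = \<zero>\<^bsub>Y n\<^esub>"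
    and "m = n \<Longrightarrow> \<beta> n \<zero>\<^bsub>Y m\<^esub> = \<zero>\<^bsub>X n\<^esub>"
    and "m = n \<Longrightarrow> \<gamma> n \<zero>\<^bsub>X m\<^esub> = \<zero>\<^bsub>X (n + 1)\<^esub>"
  by (auto simp: linear_map_zero[OF dh_lin] linear_map_zero[OF \<delta>_lin]
      linear_map_zero[OF \<alpha>_lin] linear_map_zero[OF \<beta>_lin] linear_map_zero[OF \<gamma>_lin])

lemma A_lin: "linear_map K (X n) (X n) (A n)"
proof (rule linear_mapI)
  fix x y assume x: "x \<in> carrier (X n)" and y: "y \<in> carrier (X n)"
  show "A n (x \<oplus>\<^bsub>X n\<^esub> y) = A n x \<oplus>\<^bsub>X n\<^esub> A n y"
  proof (rule A_unique)
    have "A n x \<oplus>\<^bsub>X n\<^esub> A n y = (x \<oplus>\<^bsub>X n\<^esub> \<gamma> (n - 1) (\<delta> n (A n x))) \<oplus>\<^bsub>X n\<^esub> (y \<oplus>\<^bsub>X n\<^esub> \<gamma> (n - 1) (\<delta> n (A n y)))"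
      using A_fix[OF x] A_fix[OF y] by simp
    also have "\<dots> = (x \<oplus>\<^bsub>X n\<^esub> y) \<oplus>\<^bsub>X n\<^esub> \<gamma> (n - 1) (\<delta> n (A n x \<oplus>\<^bsub>X n\<^esub> A n y))"
      using x y by (simp add: X.a_ac)
    finally show "A n x \<oplus>\<^bsub>X n\<^esub> A n y = \<dots>" .
  qed (use x y in auto)
next
  fix c x assume c: "c \<in> carrier K" and x: "x \<in> carrier (X n)"
  show "A n (c \<odot>\<^bsub>X n\<^esub> x) = c \<odot>\<^bsub>X n\<^esub> A n x"
  proof (rule A_unique)
    have "c \<odot>\<^bsub>X n\<^esub> A n x = c \<odot>\<^bsub>X n\<^esub> (x \<oplus>\<^bsub>X n\<^esub> \<gamma> (n - 1) (\<delta> n (A n x)))"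
      using A_fix[OF x] by simp
    also have "\<dots> = c \<odot>\<^bsub>X n\<^esub> x \<oplus>\<^bsub>X n\<^esub> \<gamma> (n - 1) (\<delta> n (c \<odot>\<^bsub>X n\<^esub> A n x))"
      using x c linear_map_smult[OF \<gamma>_lin, of c "\<delta> n (A n x)" "n - 1"]
      by (simp add: X.smult_r_distr linear_map_smult[OF \<delta>_lin])
    finally show "c \<odot>\<^bsub>X n\<^esub> A n x = \<dots>" .
  qed (use x c in auto)
qed (auto intro: X.vectorspace_axioms)

lemmas A_add [simp] = linear_map_add[OF A_lin]
lemmas A_zero [simp] = linear_map_zero[OF A_lin]

definition S :: "int \<Rightarrow> 'a \<Rightarrow> 'a" where "S n x = \<delta> n (A n x)"

text \<open>\<open>A'\<close> is the inverse of \<open>1 - \<delta>\<gamma>\<close>, written in terms of the inverse \<open>A\<close> of \<open>1 - \<gamma>\<delta>\<close>.\<close>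

definition A' :: "int \<Rightarrow> 'a \<Rightarrow> 'a" where "A' n x = x \<oplus>\<^bsub>X n\<^esub> S (n + 1) (\<gamma> n x)"

definition dbar :: "int \<Rightarrow> 'b \<Rightarrow> 'b" where "dbar n y = \<alpha> (n - 1) (S n (\<beta> n y))"
definition \<alpha>bar :: "int \<Rightarrow> 'a \<Rightarrow> 'b" where
  "\<alpha>bar n x = \<alpha> n x \<oplus>\<^bsub>Y n\<^esub> \<alpha> n (S (n + 1) (\<gamma> n x))"
definition \<beta>bar :: "int \<Rightarrow> 'b \<Rightarrow> 'a" where
  "\<beta>bar n y = \<beta> n y \<oplus>\<^bsub>X n\<^esub> \<gamma> (n - 1) (S n (\<beta> n y))"
definition \<gamma>bar :: "int \<Rightarrow> 'a \<Rightarrow> 'a" where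
  "\<gamma>bar n x = \<gamma> n x \<oplus>\<^bsub>X (n + 1)\<^esub> \<gamma> n (S (n + 1) (\<gamma> n x))"

lemma S_lin: "linear_map K (X n) (X (n - 1)) (S n)"
  unfolding S_def by (rule linear_map_comp[OF A_lin \<delta>_lin])

lemma S_closed [simp]: "x \<in> carrier (X n) \<Longrightarrow> m = n - 1 \<Longrightarrow> S n x \<in> carrier (X m)"
  by (simp add: S_def)

lemma S\<gamma>_lin: "linear_map K (X n) (X n) (\<lambda>x. S (n + 1) (\<gamma> n x))"
  using linear_map_comp[OF \<gamma>_lin S_lin] by simp

lemma A'_lin: "linear_map K (X n) (X n) (A' n)"
  unfolding A'_def
  by (rule linear_map_sum[OF _ S\<gamma>_lin])
    (auto intro: linear_mapI X.vectorspace_axioms)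

lemma A'_closed [simp]: "x \<in> carrier (X n) \<Longrightarrow> A' n x \<in> carrier (X n)"
  by (rule linear_map_closed[OF A'_lin])
lemmas A'_add [simp] = linear_map_add[OF A'_lin]
lemmas A'_zero [simp] = linear_map_zero[OF A'_lin]

lemma \<alpha>bar_eq: "x \<in> carrier (X n) \<Longrightarrow> \<alpha>bar n x = \<alpha> n (A' n x)"
  by (simp add: \<alpha>bar_def A'_def)

lemma \<beta>bar_eq: "y \<in> carrier (Y n) \<Longrightarrow> \<beta>bar n y = A n (\<beta> n y)"
  using A_fix[of "\<beta> n y" n] by (simp add: \<beta>bar_def S_def)

lemma \<gamma>bar_eq: "x \<in> carrier (X n) \<Longrightarrow> \<gamma>bar n x = A (n + 1) (\<gamma> n x)"
  using A_fix[of "\<gamma> n x" "n + 1"] by (simp add: \<gamma>bar_def S_def)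

lemma \<gamma>_A': "x \<in> carrier (X n) \<Longrightarrow> \<gamma> n (A' n x) = A (n + 1) (\<gamma> n x)"
  using A_fix[of "\<gamma> n x" "n + 1"] by (simp add: A'_def S_def)

text \<open>This is \<open>(1 - \<delta>\<gamma>)^{-1} \<delta> = \<delta> (1 - \<gamma>\<delta>)^{-1}\<close>.\<close>

lemma A'_\<delta>:
  assumes x: "x \<in> carrier (X n)"
  shows "A' (n - 1) (\<delta> n x) = \<delta> n (A n x)"
proof -
  have "A n x = x \<oplus>\<^bsub>X n\<^esub> A n (\<gamma> (n - 1) (\<delta> n x))"
  proof (rule A_unique)
    let ?g = "\<gamma> (n - 1) (\<delta> n x)"
    have "x \<oplus>\<^bsub>X n\<^esub> A n ?g = x \<oplus>\<^bsub>X n\<^esub> (?g \<oplus>\<^bsub>X n\<^esub> \<gamma> (n - 1) (\<delta> n (A n ?g)))"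
      using A_fix[of ?g n] x by simp
    also have "\<dots> = x \<oplus>\<^bsub>X n\<^esub> \<gamma> (n - 1) (\<delta> n (x \<oplus>\<^bsub>X n\<^esub> A n ?g))"
      using x by simp
    finally show "x \<oplus>\<^bsub>X n\<^esub> A n ?g = \<dots>" .
  qed (use x in auto)
  then have "\<delta> n (A n x) = \<delta> n (x \<oplus>\<^bsub>X n\<^esub> A n (\<gamma> (n - 1) (\<delta> n x)))"
    by (rule arg_cong)
  then show ?thesis
    using x by (simp add: A'_def S_def)
qed

text \<open>The two halves of \<open>A'\<close> being a two-sided inverse of \<open>1 - \<delta>\<gamma>\<close>.\<close>

lemma A'_fix:
  assumes x: "x \<in> carrier (X n)"
  shows "A' n x = x \<oplus>\<^bsub>X n\<^esub> \<delta> (n + 1) (\<gamma> n (A' n x))"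
  using x by (simp add: \<gamma>_A') (simp add: A'_def S_def)

lemma A'_fix':
  assumes x: "x \<in> carrier (X n)"
  shows "A' n x = x \<oplus>\<^bsub>X n\<^esub> A' n (\<delta> (n + 1) (\<gamma> n x))"
  using x A'_\<delta>[of "\<gamma> n x" "n + 1"] by (simp add: A'_def S_def)

text \<open>
  The mixed part of \<open>(dh + \<delta>)(dh + \<delta>) = 0\<close>. It is the only way in which \<open>d\<close> being a differential enters the
  three identities \<open>d_\<beta>bar\<close>, \<open>\<alpha>bar_d\<close> and \<open>\<beta>bar_\<alpha>bar\<close>.
\<close>

lemma square_zero_expanded:
  assumes x: "x \<in> carrier (X n)"
  shows "dh (n - 1) (\<delta> n x) \<oplus>\<^bsub>X (n - 2)\<^esub> \<delta> (n - 1) (dh n x) \<oplus>\<^bsub>X (n - 2)\<^esub> \<delta> (n - 1) (\<delta> n x)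
           = \<zero>\<^bsub>X (n - 2)\<^esub>"
proof -
  have "\<zero>\<^bsub>X (n - 2)\<^esub> = d (n - 1) (d n x)"
    using complex x by (simp add: chain_complex_def)
  also have "\<dots> = dh (n - 1) (d n x) \<oplus>\<^bsub>X (n - 2)\<^esub> \<delta> (n - 1) (d n x)"
    using d_eq[of "d n x" "n - 1"] x by simp
  also have "\<dots> = dh (n - 1) (\<delta> n x) \<oplus>\<^bsub>X (n - 2)\<^esub> \<delta> (n - 1) (dh n x) \<oplus>\<^bsub>X (n - 2)\<^esub> \<delta> (n - 1) (\<delta> n x)"
    using x by (simp add: d_eq dh_dh X.a_ac)
  finally show ?thesis by simp
qed

lemma \<alpha>bar_lin: "linear_map K (X n) (Y n) (\<alpha>bar n)"
  unfolding \<alpha>bar_def by (intro linear_map_sum \<alpha>_lin linear_map_comp[OF S\<gamma>_lin])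

lemma \<gamma>S_lin: "linear_map K (X n) (X n) (\<lambda>x. \<gamma> (n - 1) (S n x))"
  using linear_map_comp[OF S_lin \<gamma>_lin] by simp

lemma \<beta>bar_lin: "linear_map K (Y n) (X n) (\<beta>bar n)"
  unfolding \<beta>bar_def by (intro linear_map_sum \<beta>_lin linear_map_comp[OF \<beta>_lin \<gamma>S_lin])

lemma \<gamma>bar_lin: "linear_map K (X n) (X (n + 1)) (\<gamma>bar n)"
  unfolding \<gamma>bar_def by (intro linear_map_sum \<gamma>_lin linear_map_comp[OF S\<gamma>_lin])

lemma dbar_lin: "linear_map K (Y n) (Y (n - 1)) (dbar n)"
  unfolding dbar_def
  by (intro linear_map_comp[OF \<beta>_lin linear_map_comp[OF S_lin \<alpha>_lin]])

text \<open>
  The annihilation identities hold because \<open>\<alpha>bar\<close> and \<open>\<gamma>bar\<close> end in \<open>\<alpha>\<close> or \<open>\<gamma>\<close> while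
  \<open>\<beta>bar\<close> and \<open>\<gamma>bar\<close> begin with \<open>\<beta>\<close> or \<open>\<gamma>\<close>; where two such maps meet in a product, the composite is zero,
  except for \<open>\<alpha>\<beta> = 1\<close>.
\<close>

lemma \<alpha>bar_\<beta>bar:
  assumes y: "y \<in> carrier (Y n)"
  shows "\<alpha>bar n (\<beta>bar n y) = y"
proof -
  have "\<gamma> n (\<beta>bar n y) = \<zero>\<^bsub>X (n + 1)\<^esub>"
    using y \<gamma>_\<gamma>[of "S n (\<beta> n y)" "n - 1"] by (simp add: \<beta>bar_def \<gamma>_\<beta>)
  then show ?thesis
    using y \<alpha>_\<gamma>[of "S n (\<beta> n y)" "n - 1"]
    by (simp add: \<alpha>bar_def S_def[of "n + 1"]) (simp add: \<beta>bar_def \<alpha>_\<beta>)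
qed

lemma \<gamma>_\<gamma>bar:
  assumes x: "x \<in> carrier (X n)"
  shows "\<gamma> (n + 1) (\<gamma>bar n x) = \<zero>\<^bsub>X (n + 2)\<^esub>"
  using x by (simp add: \<gamma>bar_def \<gamma>_\<gamma>)

lemma \<alpha>bar_\<gamma>bar:
  assumes x: "x \<in> carrier (X n)"
  shows "\<alpha>bar (n + 1) (\<gamma>bar n x) = \<zero>\<^bsub>Y (n + 1)\<^esub>"
  using x by (simp add: \<alpha>bar_def \<gamma>_\<gamma>bar S_def) (simp add: \<gamma>bar_def \<alpha>_\<gamma>)

lemma \<gamma>bar_\<beta>bar:
  assumes y: "y \<in> carrier (Y n)"
  shows "\<gamma>bar n (\<beta>bar n y) = \<zero>\<^bsub>X (n + 1)\<^esub>"
proof -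
  have "\<gamma> n (\<beta>bar n y) = \<zero>\<^bsub>X (n + 1)\<^esub>"
    using y \<gamma>_\<gamma>[of "S n (\<beta> n y)" "n - 1"] by (simp add: \<beta>bar_def \<gamma>_\<beta>)
  then show ?thesis by (simp add: \<gamma>bar_def S_def)
qed

lemma \<gamma>bar_\<gamma>bar:
  assumes x: "x \<in> carrier (X n)"
  shows "\<gamma>bar (n + 1) (\<gamma>bar n x) = \<zero>\<^bsub>X (n + 2)\<^esub>"
  using x by (simp add: \<gamma>bar_def[of "n + 1"] \<gamma>_\<gamma>bar S_def)

text \<open>
  With \<open>y = A\<beta>z\<close> the claim is \<open>dy = A(\<beta>\<alpha>\<delta>y)\<close>, that is, \<open>dy = \<beta>\<alpha>\<delta>y + \<gamma>\<delta>dy\<close>. Expanding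
  \<open>\<beta>\<alpha> = 1 + dh \<gamma> + \<gamma> dh\<close> and using \<open>dh y = dh \<gamma>\<delta>y\<close>, a consequence of \<open>dh \<beta> = 0\<close>, the right-hand side is
  \<open>\<delta>y + dh y\<close> plus \<open>\<gamma>\<close> applied to \<open>dh \<delta>y + \<delta> dh y + \<delta>\<delta>y = 0\<close>.
\<close>

lemma d_\<beta>bar:
  assumes z: "z \<in> carrier (Y n)"
  shows "d n (\<beta>bar n z) = \<beta>bar (n - 1) (dbar n z)"
proof -
  define y where "y = \<beta>bar n z"
  have y: "y \<in> carrier (X n)" and y_eq: "y = A n (\<beta> n z)"
    using z by (auto simp: y_def \<beta>bar_eq)
  have "dh n y = dh n (\<beta> n z \<oplus>\<^bsub>X n\<^esub> \<gamma> (n - 1) (\<delta> n y))"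
    using A_fix[of "\<beta> n z" n] z by (simp add: y_eq)
  then have dhy: "dh n y = dh n (\<gamma> (n - 1) (\<delta> n y))"
    using y z by (simp add: dh_\<beta>)
  have fill: "\<gamma> (n - 2) (dh (n - 1) (\<delta> n y)) \<oplus>\<^bsub>X (n - 1)\<^esub> (\<gamma> (n - 2) (\<delta> (n - 1) (dh n y))
      \<oplus>\<^bsub>X (n - 1)\<^esub> \<gamma> (n - 2) (\<delta> (n - 1) (\<delta> n y))) = \<zero>\<^bsub>X (n - 1)\<^esub>"
    using arg_cong[OF square_zero_expanded[OF y], of "\<gamma> (n - 2)"] y by (simp add: X.a_assoc)
  have "A (n - 1) (\<beta> (n - 1) (\<alpha> (n - 1) (\<delta> n y))) = d n y"
  proof (rule A_unique)
    have "\<beta> (n - 1) (\<alpha> (n - 1) (\<delta> n y)) \<oplus>\<^bsub>X (n - 1)\<^esub> \<gamma> (n - 1 - 1) (\<delta> (n - 1) (d n y))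
      = \<delta> n y \<oplus>\<^bsub>X (n - 1)\<^esub> dh n y \<oplus>\<^bsub>X (n - 1)\<^esub> \<gamma> (n - 2) (dh (n - 1) (\<delta> n y))
         \<oplus>\<^bsub>X (n - 1)\<^esub> (\<gamma> (n - 2) (\<delta> (n - 1) (dh n y)) \<oplus>\<^bsub>X (n - 1)\<^esub> \<gamma> (n - 2) (\<delta> (n - 1) (\<delta> n y)))"
      using y \<beta>_\<alpha>[of "\<delta> n y" "n - 1"] by (simp add: d_eq dhy[symmetric])
    also have "\<dots> = \<delta> n y \<oplus>\<^bsub>X (n - 1)\<^esub> dh n y"
      using y fill by (simp add: X.a_assoc)
    finally show "d n y = \<beta> (n - 1) (\<alpha> (n - 1) (\<delta> n y))
        \<oplus>\<^bsub>X (n - 1)\<^esub> \<gamma> (n - 1 - 1) (\<delta> (n - 1) (d n y))"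
      using y by (simp add: d_eq X.a_comm)
  qed (use y in auto)
  then show ?thesis
    using y z by (simp add: y_def[symmetric] \<beta>bar_eq dbar_def S_def) (simp add: y_eq)
qed

text \<open>
  Dual to \<open>d_\<beta>bar\<close>. Put \<open>w = A'x\<close>, so that \<open>w = x + \<delta>\<gamma>w\<close>. By \<open>A'\<delta> = \<delta>A\<close> the right-hand side is
  \<open>\<alpha>A'\<delta>\<beta>\<alpha>w\<close>; expanding \<open>\<beta>\<alpha>\<close> and absorbing \<open>\<alpha>A'\<delta>\<gamma> dh w = \<alpha>A' dh w\<close>, a consequence of \<open>\<alpha> dh = 0\<close>, it becomes
  \<open>\<alpha>A'\<close> applied to \<open>dw + \<delta> dh \<gamma>w = dx + (d\<delta>\<gamma>w + \<delta> dh \<gamma>w)\<close>, whose bracket vanishes.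
\<close>

lemma \<alpha>bar_d:
  assumes x: "x \<in> carrier (X n)"
  shows "\<alpha>bar (n - 1) (d n x) = dbar n (\<alpha>bar n x)"
proof -
  define w where "w = A' n x"
  define g where "g = \<gamma> n w"
  have w: "w \<in> carrier (X n)" using x by (simp add: w_def)
  then have g: "g \<in> carrier (X (n + 1))" by (simp add: g_def)
  have w_eq: "w = x \<oplus>\<^bsub>X n\<^esub> \<delta> (n + 1) g"
    using A'_fix[OF x] by (simp add: w_def g_def)
  let ?a = "\<lambda>u. \<alpha> (n - 1) (A' (n - 1) u)"
  have a_add: "?a (u \<oplus>\<^bsub>X (n - 1)\<^esub> v) = ?a u \<oplus>\<^bsub>Y (n - 1)\<^esub> ?a v"
    if "u \<in> carrier (X (n - 1))" "v \<in> carrier (X (n - 1))" for u v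
    using that by simp
  have a_dh: "?a (dh n w) = ?a (\<delta> n (\<gamma> (n - 1) (dh n w)))"
    using w by (subst A'_fix') (auto simp: \<alpha>_dh)
  have dw: "?a (d n w) = ?a (d n x) \<oplus>\<^bsub>Y (n - 1)\<^esub> ?a (d n (\<delta> (n + 1) g))"
    using x g linear_map_add[OF d_lin] by (simp add: w_eq)
  have canc: "d n (\<delta> (n + 1) g) \<oplus>\<^bsub>X (n - 1)\<^esub> \<delta> n (dh (n + 1) g) = \<zero>\<^bsub>X (n - 1)\<^esub>"
    using square_zero_expanded[OF g] g by (simp add: d_eq X.a_ac)
  have "dbar n (\<alpha>bar n x) = ?a (\<delta> n (\<beta> n (\<alpha> n w)))"
    using x w A'_\<delta>[of "\<beta> n (\<alpha> n w)" n]
    by (simp add: dbar_def \<alpha>bar_eq S_def w_def[symmetric])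
  also have "\<delta> n (\<beta> n (\<alpha> n w)) = \<delta> n w \<oplus>\<^bsub>X (n - 1)\<^esub> \<delta> n (dh (n + 1) g)
      \<oplus>\<^bsub>X (n - 1)\<^esub> \<delta> n (\<gamma> (n - 1) (dh n w))"
    using w by (simp add: \<beta>_\<alpha> g_def)
  also have "?a \<dots> = ?a (\<delta> n w) \<oplus>\<^bsub>Y (n - 1)\<^esub> ?a (\<delta> n (dh (n + 1) g)) \<oplus>\<^bsub>Y (n - 1)\<^esub> ?a (dh n w)"
    using w g by (simp add: a_dh)
  also have "\<dots> = ?a (d n w) \<oplus>\<^bsub>Y (n - 1)\<^esub> ?a (\<delta> n (dh (n + 1) g))"
    using w g by (simp add: d_eq Y.a_ac)
  also have "\<dots> = ?a (d n x) \<oplus>\<^bsub>Y (n - 1)\<^esub> ?a (d n (\<delta> (n + 1) g) \<oplus>\<^bsub>X (n - 1)\<^esub> \<delta> n (dh (n + 1) g))"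
    using x g by (simp add: dw Y.a_assoc)
  also have "\<dots> = \<alpha>bar (n - 1) (d n x)"
    using x by (simp add: canc \<alpha>bar_eq)
  finally show ?thesis by simp
qed

text \<open>
  With \<open>w = A'x\<close>, \<open>g = \<gamma>w = \<gamma>bar x\<close> and \<open>e = \<gamma>bar (dx)\<close> the claim is \<open>A(\<beta>\<alpha>w) = x + dg + e\<close>. The right-hand side
  satisfies the fixed-point equation that characterizes the left-hand side: after expanding
  \<open>\<beta>\<alpha>w\<close> with \<open>w = x + \<delta>g\<close>, everything cancels against \<open>\<gamma>\<close> applied to
  \<open>dh \<delta>g + \<delta> dh g + \<delta>\<delta>g = 0\<close>.
\<close>

lemma \<beta>bar_\<alpha>bar:
  assumes x: "x \<in> carrier (X n)"
  shows "\<beta>bar n (\<alpha>bar n x) = x \<oplus>\<^bsub>X n\<^esub> d (n + 1) (\<gamma>bar n x) \<oplus>\<^bsub>X n\<^esub> \<gamma>bar (n - 1) (d n x)"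
proof -
  define w where "w = A' n x"
  define g where "g = \<gamma> n w"
  define e where "e = A n (\<gamma> (n - 1) (d n x))"
  have w: "w \<in> carrier (X n)" using x by (simp add: w_def)
  then have g: "g \<in> carrier (X (n + 1))" by (simp add: g_def)
  have w_eq: "w = x \<oplus>\<^bsub>X n\<^esub> \<delta> (n + 1) g"
    using A'_fix[OF x] by (simp add: w_def g_def)
  have g_eq: "\<gamma>bar n x = g"
    using x by (simp add: \<gamma>bar_eq g_def w_def \<gamma>_A')
  have e: "e \<in> carrier (X n)" and e_eq: "\<gamma>bar (n - 1) (d n x) = e"
    using x \<gamma>bar_eq[of "d n x" "n - 1"] by (auto simp: e_def)
  have e_fix: "e = \<gamma> (n - 1) (d n x) \<oplus>\<^bsub>X n\<^esub> \<gamma> (n - 1) (\<delta> n e)"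
    unfolding e_def by (rule A_fix) (use x in simp)
  have fill: "\<gamma> (n - 1) (dh n (\<delta> (n + 1) g)) \<oplus>\<^bsub>X n\<^esub> (\<gamma> (n - 1) (\<delta> n (dh (n + 1) g))
      \<oplus>\<^bsub>X n\<^esub> \<gamma> (n - 1) (\<delta> n (\<delta> (n + 1) g))) = \<zero>\<^bsub>X n\<^esub>"
    using arg_cong[OF square_zero_expanded[OF g], of "\<gamma> (n - 1)"] g by (simp add: X.a_assoc)
  have "A n (\<beta> n (\<alpha> n w)) = x \<oplus>\<^bsub>X n\<^esub> d (n + 1) g \<oplus>\<^bsub>X n\<^esub> e"
  proof (rule A_unique)
    let ?r = "x \<oplus>\<^bsub>X n\<^esub> d (n + 1) g \<oplus>\<^bsub>X n\<^esub> e"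
    let ?g = "\<gamma> (n - 1)"
    have "\<beta> n (\<alpha> n w) \<oplus>\<^bsub>X n\<^esub> ?g (\<delta> n ?r)
       = (x \<oplus>\<^bsub>X n\<^esub> \<delta> (n + 1) g \<oplus>\<^bsub>X n\<^esub> dh (n + 1) g \<oplus>\<^bsub>X n\<^esub> (?g (dh n x) \<oplus>\<^bsub>X n\<^esub> ?g (dh n (\<delta> (n + 1) g))))
         \<oplus>\<^bsub>X n\<^esub> (?g (\<delta> n x) \<oplus>\<^bsub>X n\<^esub> (?g (\<delta> n (dh (n + 1) g)) \<oplus>\<^bsub>X n\<^esub> ?g (\<delta> n (\<delta> (n + 1) g))) \<oplus>\<^bsub>X n\<^esub> ?g (\<delta> n e))"
      using w x g e by (simp add: \<beta>_\<alpha> g_def[symmetric] d_eq) (simp add: w_eq)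
    also have "\<dots> = x \<oplus>\<^bsub>X n\<^esub> (dh (n + 1) g \<oplus>\<^bsub>X n\<^esub> \<delta> (n + 1) g)
         \<oplus>\<^bsub>X n\<^esub> (?g (dh n x) \<oplus>\<^bsub>X n\<^esub> ?g (\<delta> n x) \<oplus>\<^bsub>X n\<^esub> ?g (\<delta> n e))
         \<oplus>\<^bsub>X n\<^esub> (?g (dh n (\<delta> (n + 1) g)) \<oplus>\<^bsub>X n\<^esub> (?g (\<delta> n (dh (n + 1) g)) \<oplus>\<^bsub>X n\<^esub> ?g (\<delta> n (\<delta> (n + 1) g))))"
      using x g e by (simp add: X.a_ac)
    also have "\<dots> = ?r"
      using x g e by (subst (2) e_fix) (simp add: fill d_eq)
    finally show "?r = \<beta> n (\<alpha> n w) \<oplus>\<^bsub>X n\<^esub> ?g (\<delta> n ?r)" by simp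
  qed (use w x g e in auto)
  then show ?thesis
    using x w by (simp add: \<beta>bar_eq \<alpha>bar_eq w_def[symmetric] g_eq e_eq)
qed

lemma \<beta>bar_closed: "y \<in> carrier (Y n) \<Longrightarrow> \<beta>bar n y \<in> carrier (X n)"
  by (rule linear_map_closed[OF \<beta>bar_lin])
lemma dbar_closed: "y \<in> carrier (Y n) \<Longrightarrow> dbar n y \<in> carrier (Y (n - 1))"
  by (rule linear_map_closed[OF dbar_lin])

text \<open>
  \<open>\<beta>bar\<close> intertwines \<open>dbar\<close> with \<open>d\<close> and has the left inverse \<open>\<alpha>bar\<close>, so \<open>dbar\<close> inherits square zero
  from \<open>d\<close>.
\<close>

lemma dbar_complex: "chain_complex K Y dbar"
proof -
  have "dbar (n - 1) (dbar n y) = \<zero>\<^bsub>Y (n - 2)\<^esub>" if y: "y \<in> carrier (Y n)" for n y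
  proof -
    have dy: "dbar n y \<in> carrier (Y (n - 1))" by (rule dbar_closed[OF y])
    then have ddy: "dbar (n - 1) (dbar n y) \<in> carrier (Y (n - 2))"
      using dbar_closed[of "dbar n y" "n - 1"] by simp
    have "\<beta>bar (n - 2) (dbar (n - 1) (dbar n y)) = d (n - 1) (d n (\<beta>bar n y))"
      using d_\<beta>bar[OF dy] d_\<beta>bar[OF y] by simp
    also have "\<dots> = \<zero>\<^bsub>X (n - 2)\<^esub>"
      using complex \<beta>bar_closed[OF y] by (simp add: chain_complex_def)
    finally have "\<alpha>bar (n - 2) (\<zero>\<^bsub>X (n - 2)\<^esub>) = dbar (n - 1) (dbar n y)"
      using \<alpha>bar_\<beta>bar[OF ddy] by simp
    then show ?thesis by (simp add: linear_map_zero[OF \<alpha>bar_lin])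
  qed
  then show ?thesis using dbar_lin by (simp add: chain_complex_def)
qed

theorem contraction_bar: "contraction K X d Y dbar \<alpha>bar \<beta>bar \<gamma>bar"
  unfolding contraction_def chain_map_def
  by (auto simp: \<alpha>bar_lin \<beta>bar_lin \<gamma>bar_lin \<alpha>bar_d d_\<beta>bar \<alpha>bar_\<beta>bar \<beta>bar_\<alpha>bar
      \<alpha>bar_\<gamma>bar \<gamma>bar_\<beta>bar \<gamma>bar_\<gamma>bar)

end


section \<open>Inverting a perturbation of the identity\<close>

lemma linear_map_finsum:
  assumes f: "linear_map K V W f" and g: "g \<in> I \<rightarrow> carrier V"
  shows "f (\<Oplus>\<^bsub>V\<^esub>i\<in>I. g i) = (\<Oplus>\<^bsub>W\<^esub>i\<in>I. f (g i))"
proof -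
  interpret f: linear_map K V W f by (fact f)
  show ?thesis
    using g
    by (induction I rule: infinite_finite_induct) (auto simp: Pi_def)
qed

text \<open>
  The exponent in \<open>nilpotent\<close> may depend on the element, so \<open>T\<close> need not be nilpotent; the geometric
  series of \<open>T\<close> is still a finite sum at every element and inverts \<open>1 - T\<close>.
\<close>

locale locally_nilpotent = V: vectorspace K V
  for K :: "('k, 'r) ring_scheme" and V :: "('k, 'a) module" +
  fixes T :: "'a \<Rightarrow> 'a"
  assumes T_lin: "linear_map K V V T"
    and nilpotent: "x \<in> carrier V \<Longrightarrow> \<exists>N. (T ^^ N) x = \<zero>\<^bsub>V\<^esub>"
begin

definition resolvent :: "'a \<Rightarrow> 'a" where
  "resolvent = inv_into (carrier V) (\<lambda>x. x \<ominus>\<^bsub>V\<^esub> T x)"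

lemmas T_closed [simp, intro] = linear_map_closed[OF T_lin]
lemmas T_simps [simp] = linear_map_add[OF T_lin] linear_map_zero[OF T_lin] linear_map_diff[OF T_lin]

lemma pow_closed [simp]: "x \<in> carrier V \<Longrightarrow> (T ^^ i) x \<in> carrier V"
  by (induction i) auto

lemma pow_zero [simp]: "(T ^^ i) \<zero>\<^bsub>V\<^esub> = \<zero>\<^bsub>V\<^esub>"
  by (induction i) auto

lemma geometric_sum:
  assumes x: "x \<in> carrier V"
  shows "x \<oplus>\<^bsub>V\<^esub> T (\<Oplus>\<^bsub>V\<^esub>i\<in>{..<N}. (T ^^ i) x) = (\<Oplus>\<^bsub>V\<^esub>i\<in>{..<N}. (T ^^ i) x) \<oplus>\<^bsub>V\<^esub> (T ^^ N) x"
proof (induction N)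
  case (Suc N)
  let ?s = "\<Oplus>\<^bsub>V\<^esub>i\<in>{..<N}. (T ^^ i) x"
  have s: "?s \<in> carrier V" using x by (auto intro!: V.finsum_closed)
  have sum: "(\<Oplus>\<^bsub>V\<^esub>i\<in>{..<Suc N}. (T ^^ i) x) = (T ^^ N) x \<oplus>\<^bsub>V\<^esub> ?s"
    using x by (simp add: lessThan_Suc Pi_def)
  then have "x \<oplus>\<^bsub>V\<^esub> T (\<Oplus>\<^bsub>V\<^esub>i\<in>{..<Suc N}. (T ^^ i) x) = T ((T ^^ N) x) \<oplus>\<^bsub>V\<^esub> (x \<oplus>\<^bsub>V\<^esub> T ?s)"
    using x s by (simp add: V.a_lcomm)
  also have "\<dots> = T ((T ^^ N) x) \<oplus>\<^bsub>V\<^esub> (?s \<oplus>\<^bsub>V\<^esub> (T ^^ N) x)"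
    by (simp only: Suc)
  also have "\<dots> = (\<Oplus>\<^bsub>V\<^esub>i\<in>{..<Suc N}. (T ^^ i) x) \<oplus>\<^bsub>V\<^esub> (T ^^ Suc N) x"
    using x s sum by (simp add: V.a_ac)
  finally show ?case .
qed (use x in simp)

text \<open>The difference of two solutions is fixed by \<open>T\<close>, hence by every power of \<open>T\<close>, hence zero.\<close>

lemma fixed_point_unique:
  assumes x: "x \<in> carrier V" and y: "y \<in> carrier V" and z: "z \<in> carrier V"
    and "y = x \<oplus>\<^bsub>V\<^esub> T y" "z = x \<oplus>\<^bsub>V\<^esub> T z"
  shows "y = z"
proof -
  let ?u = "y \<ominus>\<^bsub>V\<^esub> z"
  have u: "?u \<in> carrier V" using y z by simp
  have "?u = (T y \<oplus>\<^bsub>V\<^esub> x) \<ominus>\<^bsub>V\<^esub> (x \<oplus>\<^bsub>V\<^esub> T z)" using assms by (simp add: V.a_comm)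
  also have "\<dots> = T y \<ominus>\<^bsub>V\<^esub> T z"
    using x y z by (simp add: a_minus_def V.minus_add V.a_assoc V.r_neg2)
  also have "\<dots> = T ?u" using y z by simp
  finally have "T ?u = ?u" by simp
  then have "(T ^^ N) ?u = ?u" for N by (induction N) auto
  with nilpotent[OF u] have "?u = \<zero>\<^bsub>V\<^esub>" by metis
  then show ?thesis using y z by simp
qed

lemma fixed_point_iff:
  assumes "x \<in> carrier V" "y \<in> carrier V"
  shows "y \<ominus>\<^bsub>V\<^esub> T y = x \<longleftrightarrow> y = x \<oplus>\<^bsub>V\<^esub> T y"
proof
  assume "y \<ominus>\<^bsub>V\<^esub> T y = x"
  then show "y = x \<oplus>\<^bsub>V\<^esub> T y"
    using assms by (auto simp: a_minus_def V.a_assoc V.l_neg)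
next
  assume "y = x \<oplus>\<^bsub>V\<^esub> T y"
  then have "y \<ominus>\<^bsub>V\<^esub> T y = (x \<oplus>\<^bsub>V\<^esub> T y) \<ominus>\<^bsub>V\<^esub> T y" by simp
  then show "y \<ominus>\<^bsub>V\<^esub> T y = x"
    using assms by (simp add: a_minus_def V.a_assoc V.r_neg)
qed

lemma one_minus_bij: "bij_betw (\<lambda>x. x \<ominus>\<^bsub>V\<^esub> T x) (carrier V) (carrier V)"
proof (rule bij_betwI')
  fix y z assume y: "y \<in> carrier V" and z: "z \<in> carrier V"
  show "(y \<ominus>\<^bsub>V\<^esub> T y = z \<ominus>\<^bsub>V\<^esub> T z) = (y = z)"
    using fixed_point_unique[of "z \<ominus>\<^bsub>V\<^esub> T z" y z] y z fixed_point_iff[of "z \<ominus>\<^bsub>V\<^esub> T z"] by auto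
next
  fix x assume x: "x \<in> carrier V"
  then obtain N where N: "(T ^^ N) x = \<zero>\<^bsub>V\<^esub>" using nilpotent by blast
  let ?y = "\<Oplus>\<^bsub>V\<^esub>i\<in>{..<N}. (T ^^ i) x"
  have y: "?y \<in> carrier V" using x by (auto intro!: V.finsum_closed)
  have "?y = x \<oplus>\<^bsub>V\<^esub> T ?y" using geometric_sum[OF x, of N] N y by simp
  then show "\<exists>y\<in>carrier V. x = y \<ominus>\<^bsub>V\<^esub> T y" using fixed_point_iff[OF x y] y by metis
qed auto

lemma resolvent_closed: "x \<in> carrier V \<Longrightarrow> resolvent x \<in> carrier V"
  unfolding resolvent_def using one_minus_bij by (metis bij_betw_imp_surj_on inv_into_into)

lemma resolvent_fix:
  assumes "x \<in> carrier V"
  shows "resolvent x = x \<oplus>\<^bsub>V\<^esub> T (resolvent x)"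
  using bij_betw_inv_into_right[OF one_minus_bij assms] fixed_point_iff[OF assms resolvent_closed[OF assms]]
  by (simp add: resolvent_def)

lemma resolvent_unique:
  assumes "x \<in> carrier V" "y \<in> carrier V" "y = x \<oplus>\<^bsub>V\<^esub> T y"
  shows "resolvent x = y"
  using fixed_point_unique[OF assms(1) resolvent_closed[OF assms(1)] assms(2) resolvent_fix[OF assms(1)] assms(3)] .

lemma resolvent_series:
  assumes x: "x \<in> carrier V" and N: "(T ^^ N) x = \<zero>\<^bsub>V\<^esub>"
  shows "resolvent x = (\<Oplus>\<^bsub>V\<^esub>i\<in>{..<N}. (T ^^ i) x)"
proof (rule resolvent_unique)
  show y: "(\<Oplus>\<^bsub>V\<^esub>i\<in>{..<N}. (T ^^ i) x) \<in> carrier V" using x by (auto intro!: V.finsum_closed)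
  show "(\<Oplus>\<^bsub>V\<^esub>i\<in>{..<N}. (T ^^ i) x) = x \<oplus>\<^bsub>V\<^esub> T (\<Oplus>\<^bsub>V\<^esub>i\<in>{..<N}. (T ^^ i) x)"
    using geometric_sum[OF x, of N] N y by simp
qed (fact x)

end


section \<open>Direct sums and filtered maps\<close>

lemma dsum_simps:
  "\<zero>\<^bsub>dsum V\<^esub> = (\<lambda>p. \<zero>\<^bsub>V p\<^esub>)"
  "x \<oplus>\<^bsub>dsum V\<^esub> y = (\<lambda>p. x p \<oplus>\<^bsub>V p\<^esub> y p)"
  "c \<odot>\<^bsub>dsum V\<^esub> x = (\<lambda>p. c \<odot>\<^bsub>V p\<^esub> x p)"
  "x \<in> carrier (dsum V) \<longleftrightarrow> (\<forall>p. x p \<in> carrier (V p)) \<and> finite {p. x p \<noteq> \<zero>\<^bsub>V p\<^esub>}"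
  by (auto simp: dsum_def)

lemma dsum_neg:
  assumes V: "\<And>p. vectorspace K (V p)" and x: "x \<in> carrier (dsum V)"
  shows "\<ominus>\<^bsub>dsum V\<^esub> x = (\<lambda>p. \<ominus>\<^bsub>V p\<^esub> x p)"
proof -
  interpret V: vectorspace K "V p" for p by (fact V)
  interpret D: vectorspace K "dsum V" using V by (rule dsum_vectorspace)
  have "{p. \<ominus>\<^bsub>V p\<^esub> x p \<noteq> \<zero>\<^bsub>V p\<^esub>} \<subseteq> {p. x p \<noteq> \<zero>\<^bsub>V p\<^esub>}" by auto
  then have "(\<lambda>p. \<ominus>\<^bsub>V p\<^esub> x p) \<in> carrier (dsum V)"
    using x by (auto simp: dsum_simps intro: finite_subset)
  then show ?thesis
    using x by (intro D.minus_equality) (auto simp: dsum_simps V.l_neg)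
qed

text \<open>
  Being filtered is a condition on matrix entries. It is handled through the subspaces of elements supported on
  a set of grades: a linear map is filtered exactly if it preserves support in every down-set
  (\<open>filteredI\<close>, \<open>filtered_supported\<close>), and in this form it passes to composites without a matrix product.
\<close>

definition supported :: "('p \<Rightarrow> ('k, 'a) module) \<Rightarrow> 'p set \<Rightarrow> ('p \<Rightarrow> 'a) set" where
  "supported V D = {x \<in> carrier (dsum V). \<forall>p. p \<notin> D \<longrightarrow> x p = \<zero>\<^bsub>V p\<^esub>}"

lemma supported_UNIV: "supported V UNIV = carrier (dsum V)"
  by (simp add: supported_def)

lemma supported_mono: "D \<subseteq> E \<Longrightarrow> supported V D \<subseteq> supported V E"
  by (auto simp: supported_def)

lemma supportedD: "x \<in> supported V D \<Longrightarrow> x \<in> carrier (dsum V)"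
  by (simp add: supported_def)

lemma supported_zero:
  assumes "\<And>p. vectorspace K (V p)"
  shows "\<zero>\<^bsub>dsum V\<^esub> \<in> supported V D"
proof -
  interpret D: vectorspace K "dsum V" using assms by (rule dsum_vectorspace)
  show ?thesis using D.zero_closed by (simp add: supported_def) (simp add: dsum_simps)
qed

lemma supported_add:
  assumes V: "\<And>p. vectorspace K (V p)" and x: "x \<in> supported V D" and y: "y \<in> supported V D"
  shows "x \<oplus>\<^bsub>dsum V\<^esub> y \<in> supported V D"
proof -
  interpret V: vectorspace K "V p" for p by (fact V)
  interpret D: vectorspace K "dsum V" using V by (rule dsum_vectorspace)
  have "x \<oplus>\<^bsub>dsum V\<^esub> y \<in> carrier (dsum V)" using x y by (simp add: supported_def)
  then show ?thesis using x y by (simp add: supported_def) (simp add: dsum_simps)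
qed

lemma supported_finsum:
  assumes V: "\<And>p. vectorspace K (V p)" and g: "\<And>i. i \<in> I \<Longrightarrow> g i \<in> supported V D"
  shows "(\<Oplus>\<^bsub>dsum V\<^esub>i\<in>I. g i) \<in> supported V D"
proof -
  interpret D: vectorspace K "dsum V" using V by (rule dsum_vectorspace)
  show ?thesis
    using g
  proof (induction I rule: infinite_finite_induct)
    case (insert i I)
    then show ?case
      by (subst D.finsum_insert) (auto simp: Pi_def intro: supportedD supported_add[OF V])
  qed (auto intro: supported_zero[OF V])
qed

lemma ginc_supported:
  assumes V: "\<And>p. vectorspace K (V p)" and "v \<in> carrier (V q)" "q \<in> D"
  shows "ginc V q v \<in> supported V D"
proof -
  interpret V: vectorspace K "V p" for p by (fact V)
  have "finite {p. ginc V q v p \<noteq> \<zero>\<^bsub>V p\<^esub>}"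
    by (rule finite_subset[of _ "{q}"]) (auto simp: ginc_def)
  then show ?thesis using assms(2,3) by (auto simp: supported_def dsum_simps ginc_def)
qed

lemma ginc_closed:
  assumes V: "\<And>p. vectorspace K (V p)" and "v \<in> carrier (V q)"
  shows "ginc V q v \<in> carrier (dsum V)"
  using ginc_supported[of K V, OF V assms(2), of UNIV] by (simp add: supported_def)

lemma ginc_linear:
  assumes V: "\<And>p. vectorspace K (V p)"
  shows "linear_map K (V q) (dsum V) (ginc V q)"
proof -
  interpret V: vectorspace K "V p" for p by (fact V)
  show ?thesis
    by (rule linear_mapI) (auto simp: ginc_closed[OF V] dsum_simps ginc_def
        intro: V dsum_vectorspace)
qed

lemma gproj_linear:
  assumes V: "\<And>p. vectorspace K (V p)"
  shows "linear_map K (dsum V) (V q) (gproj q)"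
  by (rule linear_mapI) (auto simp: dsum_simps gproj_def intro: V dsum_vectorspace)

text \<open>
  The direct sum is generated by its homogeneous elements, relative to a set \<open>D\<close> of grades; the proof removes
  one grade of the support at a time.
\<close>

lemma supported_induct [consumes 2, case_names zero add]:
  assumes V: "\<And>p. vectorspace K (V p)" and "x \<in> supported V D"
    and zero: "P \<zero>\<^bsub>dsum V\<^esub>"
    and add: "\<And>q v y. q \<in> D \<Longrightarrow> v \<in> carrier (V q) \<Longrightarrow> y \<in> supported V D \<Longrightarrow> P y \<Longrightarrow>
                P (ginc V q v \<oplus>\<^bsub>dsum V\<^esub> y)"
  shows "P x"
proof -
  interpret V: vectorspace K "V p" for p by (fact V)
  have "P x" if "finite F" "x \<in> supported V D" "{p. x p \<noteq> \<zero>\<^bsub>V p\<^esub>} \<subseteq> F" for F x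
    using that
  proof (induction F arbitrary: x rule: finite_induct)
    case empty
    then have "x = \<zero>\<^bsub>dsum V\<^esub>" by (auto simp: dsum_simps)
    then show ?case using zero by simp
  next
    case (insert q F)
    show ?case
    proof (cases "x q = \<zero>\<^bsub>V q\<^esub>")
      case True
      with insert.prems have "{p. x p \<noteq> \<zero>\<^bsub>V p\<^esub>} \<subseteq> F" by auto
      then show ?thesis using insert.IH insert.prems by simp
    next
      case False
      then have q: "q \<in> D" and xq: "x q \<in> carrier (V q)" and xp: "\<And>p. x p \<in> carrier (V p)"
        using insert.prems by (auto simp: supported_def dsum_simps)
      let ?y = "x(q := \<zero>\<^bsub>V q\<^esub>)"
      have sub: "{p. ?y p \<noteq> \<zero>\<^bsub>V p\<^esub>} \<subseteq> F" using insert.prems by auto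
      then have "finite {p. ?y p \<noteq> \<zero>\<^bsub>V p\<^esub>}" using insert.hyps(1) by (rule finite_subset)
      then have y: "?y \<in> supported V D"
        using insert.prems xp by (auto simp: supported_def dsum_simps)
      have eq: "x = ginc V q (x q) \<oplus>\<^bsub>dsum V\<^esub> ?y"
        using xp by (auto simp: dsum_simps ginc_def)
      show ?thesis
        using add[OF q xq y insert.IH[OF y sub]] by (simp only: eq[symmetric])
    qed
  qed
  then show ?thesis using assms(2) by (auto simp: supported_def dsum_simps)
qed

lemma supported_map:
  assumes f: "linear_map K (dsum V) (dsum W) f"
    and V: "\<And>p. vectorspace K (V p)" and W: "\<And>p. vectorspace K (W p)"
    and gen: "\<And>q v. q \<in> D \<Longrightarrow> v \<in> carrier (V q) \<Longrightarrow> f (ginc V q v) \<in> supported W E"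
    and x: "x \<in> supported V D"
  shows "f x \<in> supported W E"
  using V x
proof (induction rule: supported_induct)
  case zero
  show ?case using supported_zero[OF W] by (simp add: linear_map_zero[OF f])
next
  case (add q v y)
  then have "f (ginc V q v \<oplus>\<^bsub>dsum V\<^esub> y) = f (ginc V q v) \<oplus>\<^bsub>dsum W\<^esub> f y"
    by (intro linear_map_add[OF f] ginc_closed[OF V] supportedD)
  then show ?case using gen add by (auto intro: supported_add[OF W])
qed

lemma filteredI:
  assumes "\<And>q v. v \<in> carrier (V q) \<Longrightarrow> f (ginc V q v) \<in> supported W {..q}"
  shows "filtered V W f"
  using assms by (fastforce simp: filtered_def component_def gproj_def supported_def)

lemma filtered_supported:
  assumes fil: "filtered V W f" and f: "linear_map K (dsum V) (dsum W) f"
    and V: "\<And>p. vectorspace K (V p)" and W: "\<And>p. vectorspace K (W p)"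
    and down: "\<And>p q. q \<in> D \<Longrightarrow> p \<le> q \<Longrightarrow> p \<in> D"
    and x: "x \<in> supported V D"
  shows "f x \<in> supported W D"
proof (rule supported_map[OF f V W _ x])
  fix q v assume q: "q \<in> D" and v: "v \<in> carrier (V q)"
  have "f (ginc V q v) \<in> carrier (dsum W)"
    by (rule linear_map_closed[OF f ginc_closed[of K V, OF V v]])
  then show "f (ginc V q v) \<in> supported W D"
    using fil v down[OF q] by (auto simp: supported_def filtered_def component_def gproj_def)
qed

text \<open>
  For \<open>v\<close> of grade \<open>q\<close>, the image \<open>T v\<close> is a finite sum of homogeneous elements of grades below \<open>q\<close>; each
  is killed by a power of \<open>T\<close> by well-founded induction, so the largest of the finitely many
  exponents kills \<open>T v\<close>.
\<close>

lemma locally_nilpotent_if_lowering: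
  fixes V :: "'p::order \<Rightarrow> ('k, 'a) module"
  assumes wf: "\<not> (\<exists>s :: nat \<Rightarrow> 'p. \<forall>i. s (Suc i) < s i)"
    and T: "linear_map K (dsum V) (dsum V) T"
    and V: "\<And>p. vectorspace K (V p)"
    and low: "\<And>q v. v \<in> carrier (V q) \<Longrightarrow> T (ginc V q v) \<in> supported V {..<q}"
  shows "locally_nilpotent K (dsum V) T"
proof -
  interpret T: linear_map K "dsum V" "dsum V" T by (fact T)
  let ?nil = "\<lambda>x. \<exists>N. (T ^^ N) x = \<zero>\<^bsub>dsum V\<^esub>"
  have cl: "(T ^^ N) x \<in> carrier (dsum V)" if "x \<in> carrier (dsum V)" for x N
    using that by (induction N) auto
  have pow_add: "(T ^^ N) (x \<oplus>\<^bsub>dsum V\<^esub> y) = (T ^^ N) x \<oplus>\<^bsub>dsum V\<^esub> (T ^^ N) y"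
    if "x \<in> carrier (dsum V)" "y \<in> carrier (dsum V)" for x y N
    using that by (induction N) (auto simp: cl)
  have pow_zero: "(T ^^ N) \<zero>\<^bsub>dsum V\<^esub> = \<zero>\<^bsub>dsum V\<^esub>" for N
    by (induction N) auto
  have nil_le: "(T ^^ M) x = \<zero>\<^bsub>dsum V\<^esub>" if "(T ^^ N) x = \<zero>\<^bsub>dsum V\<^esub>" "N \<le> M" for x N M
    using that pow_zero by (metis comp_apply funpow_add le_add_diff_inverse2)
  have nil_supp: "?nil x" if x: "x \<in> supported V D"
    and gen: "\<And>q v. q \<in> D \<Longrightarrow> v \<in> carrier (V q) \<Longrightarrow> ?nil (ginc V q v)" for x D
    using V x
  proof (induction rule: supported_induct)
    case zero
    show ?case using pow_zero by blast
  next
    case (add q v y)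
    then obtain M N where "(T ^^ M) (ginc V q v) = \<zero>\<^bsub>dsum V\<^esub>" "(T ^^ N) y = \<zero>\<^bsub>dsum V\<^esub>"
      using gen by blast
    then have "(T ^^ max M N) (ginc V q v) = \<zero>\<^bsub>dsum V\<^esub>" "(T ^^ max M N) y = \<zero>\<^bsub>dsum V\<^esub>"
      by (auto intro: nil_le)
    then have "(T ^^ max M N) (ginc V q v \<oplus>\<^bsub>dsum V\<^esub> y) = \<zero>\<^bsub>dsum V\<^esub>"
      using add by (simp add: pow_add ginc_closed[OF V] supportedD)
    then show ?case by blast
  qed
  have "wf {(p, q :: 'p). p < q}"
    using wf by (simp add: wf_iff_no_infinite_down_chain)
  then have gen: "\<forall>v\<in>carrier (V q). ?nil (ginc V q v)" for q
  proof (induction q rule: wf_induct_rule)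
    case (less q)
    show ?case
    proof
      fix v assume v: "v \<in> carrier (V q)"
      have "?nil (T (ginc V q v))"
        by (rule nil_supp[OF low[OF v]]) (use less in auto)
      then obtain N where "(T ^^ N) (T (ginc V q v)) = \<zero>\<^bsub>dsum V\<^esub>" by blast
      then have "(T ^^ Suc N) (ginc V q v) = \<zero>\<^bsub>dsum V\<^esub>" by (simp add: funpow_swap1)
      then show "?nil (ginc V q v)" by blast
    qed
  qed
  show ?thesis
  proof (intro locally_nilpotent.intro locally_nilpotent_axioms.intro T T.V.vectorspace_axioms)
    fix x assume "x \<in> carrier (dsum V)"
    then have "x \<in> supported V UNIV" by (simp add: supported_UNIV)
    then show "?nil x" by (rule nil_supp) (use gen in auto)
  qed
qed

text \<open>
  The defining sum runs over the support of the argument; outside the support the linear map \<open>\<phi> p\<close> gives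
  zero anyway, so the coordinates are given by one formula.
\<close>

lemma graded_sum_apply:
  assumes \<phi>: "\<And>p. linear_map K (V p) (W p) (\<phi> p)" and x: "x \<in> carrier (dsum V)"
  shows "graded_sum V W \<phi> x = (\<lambda>p. \<phi> p (x p))"
proof
  fix p
  have V: "vectorspace K (V p)" and W: "vectorspace K (W p)" for p
    using \<phi> by (auto dest: linear_mapD)
  interpret W: vectorspace K "W p" for p by (fact W)
  let ?F = "{p. gproj p x \<noteq> \<zero>\<^bsub>V p\<^esub>}"
  let ?g = "\<lambda>q. ginc W q (\<phi> q (gproj q x))"
  have xq: "gproj q x \<in> carrier (V q)" for q using x by (simp add: gproj_def dsum_simps)
  have g: "?g q \<in> carrier (dsum W)" for q
    by (intro ginc_closed[OF W] linear_map_closed[OF \<phi>] xq)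
  have "graded_sum V W \<phi> x p = (\<Oplus>\<^bsub>W p\<^esub>q\<in>?F. gproj p (?g q))"
    using linear_map_finsum[OF gproj_linear[of K W p, OF W], of ?g ?F] g
    by (simp add: graded_sum_def gproj_def)
  also have "\<dots> = (\<Oplus>\<^bsub>W p\<^esub>q\<in>?F \<inter> {p}. gproj p (?g q))"
    by (rule W.add.finprod_mono_neutral_cong_right)
      (use x g in \<open>auto simp: gproj_def ginc_def dsum_simps\<close>)
  also have "\<dots> = \<phi> p (x p)"
  proof (cases "p \<in> ?F")
    case True
    then have "?F \<inter> {p} = {p}" by auto
    then show ?thesis using linear_map_closed[OF \<phi>[of p] xq]
      by (simp add: ginc_def gproj_def)
  next
    case False
    then have "?F \<inter> {p} = {}" by auto
    then show ?thesis using False linear_map_zero[OF \<phi>[of p]] by (simp add: gproj_def)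
  qed
  finally show "graded_sum V W \<phi> x p = \<phi> p (x p)" .
qed

lemma graded_sum_linear:
  assumes \<phi>: "\<And>p. linear_map K (V p) (W p) (\<phi> p)"
  shows "linear_map K (dsum V) (dsum W) (graded_sum V W \<phi>)"
proof (rule linear_mapI)
  show V: "vectorspace K (dsum V)" and W: "vectorspace K (dsum W)"
    using \<phi> by (auto intro!: dsum_vectorspace dest: linear_mapD)
  interpret V: vectorspace K "dsum V" by (fact V)
  fix x assume x: "x \<in> carrier (dsum V)"
  have "{p. \<phi> p (x p) \<noteq> \<zero>\<^bsub>W p\<^esub>} \<subseteq> {p. x p \<noteq> \<zero>\<^bsub>V p\<^esub>}"
    by (auto simp: linear_map_zero[OF \<phi>])
  then show "graded_sum V W \<phi> x \<in> carrier (dsum W)"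
    using x by (auto simp: graded_sum_apply[OF \<phi> x] dsum_simps
        intro: finite_subset linear_map_closed[OF \<phi>])
  fix y assume y: "y \<in> carrier (dsum V)"
  show "graded_sum V W \<phi> (x \<oplus>\<^bsub>dsum V\<^esub> y) = graded_sum V W \<phi> x \<oplus>\<^bsub>dsum W\<^esub> graded_sum V W \<phi> y"
    using x y by (simp add: graded_sum_apply[OF \<phi>])
      (auto simp: dsum_simps linear_map_add[OF \<phi>])
next
  interpret V: vectorspace K "dsum V"
    using \<phi> by (auto intro!: dsum_vectorspace dest: linear_mapD)
  fix c x assume "c \<in> carrier K" "x \<in> carrier (dsum V)"
  then show "graded_sum V W \<phi> (c \<odot>\<^bsub>dsum V\<^esub> x) = c \<odot>\<^bsub>dsum W\<^esub> graded_sum V W \<phi> x"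
    by (simp add: graded_sum_apply[OF \<phi>]) (auto simp: dsum_simps linear_map_smult[OF \<phi>])
qed

lemma graded_sum_filtered:
  assumes \<phi>: "\<And>p. linear_map K (V p) (W p) (\<phi> p)"
  shows "filtered V W (graded_sum V W \<phi>)"
proof (rule filteredI)
  fix q v assume v: "v \<in> carrier (V q)"
  have V: "vectorspace K (V p)" for p using \<phi> by (auto dest: linear_mapD)
  have i: "ginc V q v \<in> carrier (dsum V)" by (rule ginc_closed[of K V, OF V v])
  show "graded_sum V W \<phi> (ginc V q v) \<in> supported W {..q}"
    using linear_map_closed[OF graded_sum_linear[OF \<phi>] i] fun_cong[OF graded_sum_apply[OF \<phi> i]]
    by (auto simp: supported_def) (auto simp: ginc_def linear_map_zero[OF \<phi>])
qed


section \<open>Homology decompositions of a single complex\<close>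

lemma linear_map_inv_into:
  assumes f: "linear_map K V W f" and bij: "bij_betw f (carrier V) (carrier W)"
  shows "linear_map K W V (inv_into (carrier V) f)"
proof -
  interpret f: linear_map K V W f by (fact f)
  note inj = bij_betw_imp_inj_on[OF bij]
  have cl: "inv_into (carrier V) f y \<in> carrier V" if "y \<in> carrier W" for y
    using that bij by (metis bij_betw_imp_surj_on inv_into_into)
  have r: "f (inv_into (carrier V) f y) = y" if "y \<in> carrier W" for y
    by (rule bij_betw_inv_into_right[OF bij that])
  show ?thesis
  proof (rule linear_mapI)
    fix x y assume "x \<in> carrier W" "y \<in> carrier W"
    then show "inv_into (carrier V) f (x \<oplus>\<^bsub>W\<^esub> y) = inv_into (carrier V) f x \<oplus>\<^bsub>V\<^esub> inv_into (carrier V) f y"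
      by (intro inv_into_f_eq[OF inj]) (auto simp: cl r)
  next
    fix c x assume "c \<in> carrier K" "x \<in> carrier W"
    then show "inv_into (carrier V) f (c \<odot>\<^bsub>W\<^esub> x) = c \<odot>\<^bsub>V\<^esub> inv_into (carrier V) f x"
      by (intro inv_into_f_eq[OF inj]) (auto simp: cl r)
  qed (auto intro: cl linear_mapD[OF f])
qed

lemma direct_sum_simps:
  "\<zero>\<^bsub>direct_sum V W\<^esub> = (\<zero>\<^bsub>V\<^esub>, \<zero>\<^bsub>W\<^esub>)"
  "x \<oplus>\<^bsub>direct_sum V W\<^esub> y = (fst x \<oplus>\<^bsub>V\<^esub> fst y, snd x \<oplus>\<^bsub>W\<^esub> snd y)"
  "c \<odot>\<^bsub>direct_sum V W\<^esub> x = (c \<odot>\<^bsub>V\<^esub> fst x, c \<odot>\<^bsub>W\<^esub> snd x)"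
  "x \<in> carrier (direct_sum V W) \<longleftrightarrow> fst x \<in> carrier V \<and> snd x \<in> carrier W"
  by (auto simp: direct_sum_def mem_Times_iff split: prod.splits)

lemma direct_sum_linear:
  assumes V: "vectorspace K V" and W: "vectorspace K W"
  shows fst_linear: "linear_map K (direct_sum V W) V fst"
    and snd_linear: "linear_map K (direct_sum V W) W snd"
    and inl_linear: "linear_map K V (direct_sum V W) (\<lambda>x. (x, \<zero>\<^bsub>W\<^esub>))"
    and inr_linear: "linear_map K W (direct_sum V W) (\<lambda>x. (\<zero>\<^bsub>V\<^esub>, x))"
proof -
  interpret V: vectorspace K V by (fact V)
  interpret W: vectorspace K W by (fact W)
  note D = direct_sum_is_vs[OF V W]
  show "linear_map K (direct_sum V W) V fst" "linear_map K (direct_sum V W) W snd"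
    "linear_map K V (direct_sum V W) (\<lambda>x. (x, \<zero>\<^bsub>W\<^esub>))"
    "linear_map K W (direct_sum V W) (\<lambda>x. (\<zero>\<^bsub>V\<^esub>, x))"
    by (rule linear_mapI; auto simp: direct_sum_simps V W D)+
qed

lemma direct_sum_neg:
  assumes V: "vectorspace K V" and W: "vectorspace K W" and x: "x \<in> carrier (direct_sum V W)"
  shows "\<ominus>\<^bsub>direct_sum V W\<^esub> x = (\<ominus>\<^bsub>V\<^esub> fst x, \<ominus>\<^bsub>W\<^esub> snd x)"
  using linear_map_neg[OF fst_linear[OF V W] x] linear_map_neg[OF snd_linear[OF V W] x]
  by (simp add: prod_eq_iff)

text \<open>
  In the coordinates \<open>(h, b, k)\<close> provided by \<open>\<zeta>\<close> all maps are explicit: \<open>t\<close> is \<open>(0, k, 0)\<close> (\<open>\<zeta>_t\<close>), \<open>beta\<close>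
  is \<open>(h, 0, 0)\<close> (\<open>\<zeta>_beta\<close>), and \<open>gamma\<close> is \<open>(0, 0, -b)\<close> (\<open>\<zeta>_gamma\<close>). As \<open>\<zeta>\<close> is injective, the
  identities of a contraction onto homology can be checked there.
\<close>

locale decomposed_complex =
  fixes K :: "('k, 'r) ring_scheme" and X :: "int \<Rightarrow> ('k, 'a) module"
    and t :: "int \<Rightarrow> 'a \<Rightarrow> 'a" and \<zeta> :: "int \<Rightarrow> 'a \<Rightarrow> 'a set \<times> 'a \<times> 'a"
  assumes complex: "chain_complex K X t"
    and decomposition: "homology_decomposition K X t \<zeta>"
begin

lemma t_lin: "linear_map K (X n) (X (n - 1)) (t n)"
  using complex by (simp add: chain_complex_def)

lemma t_t: "x \<in> carrier (X n) \<Longrightarrow> t (n - 1) (t n x) = \<zero>\<^bsub>X (n - 2)\<^esub>"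
  using complex by (simp add: chain_complex_def)

sublocale X: vectorspace K "X n" for n
  using t_lin by (rule linear_mapD)

lemma boundaries_submodule: "submodule K (boundaries X t n) (X n)"
proof -
  interpret t: linear_map K "X (n + 1)" "X n" "t (n + 1)"
    using t_lin[of "n + 1"] by simp
  show ?thesis using t.mod_hom.im_is_submodule by (simp add: t.mod_hom.im_def boundaries_def)
qed

lemma boundary_space_vectorspace: "vectorspace K (boundary_space X t n)"
  using X.subspace_is_vs[of "boundaries X t n"] boundaries_submodule
  by (simp add: boundary_space_def subspace_def X.vectorspace_axioms)

lemma homology_vectorspace: "vectorspace K (homology X t n)"
proof -
  interpret t: linear_map K "X n" "X (n - 1)" "t n" by (rule t_lin)
  let ?Z = "a_kernel (X n) (X (n - 1)) (t n)"
  have "submodule K ?Z (X n)"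
    using t.mod_hom.ker_is_submodule by (simp add: t.mod_hom.ker_def a_kernel_def')
  then have Z: "vectorspace K ((X n)\<lparr>carrier := ?Z\<rparr>)"
    using X.subspace_is_vs[of ?Z] by (simp add: subspace_def X.vectorspace_axioms)
  have "boundaries X t n \<subseteq> ?Z"
    using t_t[of _ "n + 1"] linear_map_closed[OF t_lin[of "n + 1"]]
    by (auto simp: boundaries_def a_kernel_def')
  then have "submodule K (boundaries X t n) ((X n)\<lparr>carrier := ?Z\<rparr>)"
    using boundaries_submodule[of n] Z by (auto simp: submodule_def vectorspace_def)
  then show ?thesis unfolding homology_def by (rule quotient_space_vectorspace[OF Z])
qed

abbreviation "B \<equiv> boundary_space X t"
abbreviation "H \<equiv> homology X t"
abbreviation "Z \<equiv> decomposed X t"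

sublocale B: vectorspace K "B n" for n by (rule boundary_space_vectorspace)
sublocale H: vectorspace K "H n" for n by (rule homology_vectorspace)
sublocale BB: vectorspace K "direct_sum (B n) (B m)" for n m
  by (rule direct_sum_is_vs[OF boundary_space_vectorspace boundary_space_vectorspace])
sublocale Z: vectorspace K "Z n" for n
  unfolding decomposed_def by (rule direct_sum_is_vs[OF homology_vectorspace BB.vectorspace_axioms])

lemma \<zeta>_lin: "linear_map K (X n) (Z n) (\<zeta> n)"
  and \<zeta>_bij: "bij_betw (\<zeta> n) (carrier (X n)) (carrier (Z n))"
  using decomposition by (auto simp: homology_decomposition_def)

lemmas \<zeta>_inv_lin = linear_map_inv_into[OF \<zeta>_lin \<zeta>_bij]
lemmas \<zeta>_inv [simp] = bij_betw_inv_into_right[OF \<zeta>_bij]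
lemmas \<zeta>_closed [simp] = linear_map_closed[OF \<zeta>_lin]

lemma \<zeta>_eqI: "x \<in> carrier (X n) \<Longrightarrow> y \<in> carrier (X n) \<Longrightarrow> \<zeta> n x = \<zeta> n y \<Longrightarrow> x = y"
  using \<zeta>_bij by (auto dest: bij_betw_imp_inj_on inj_onD)

lemma Z_carrier: "(h, b, k) \<in> carrier (Z n) \<longleftrightarrow> h \<in> carrier (H n) \<and> b \<in> carrier (B n) \<and> k \<in> carrier (B (n - 1))"
  by (simp add: decomposed_def direct_sum_simps)

lemma Z_zero: "\<zero>\<^bsub>Z n\<^esub> = (\<zero>\<^bsub>H n\<^esub>, \<zero>\<^bsub>B n\<^esub>, \<zero>\<^bsub>B (n - 1)\<^esub>)"
  by (simp add: decomposed_def direct_sum_simps)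

lemma Z_add: "(h, b, k) \<oplus>\<^bsub>Z n\<^esub> (h', b', k') = (h \<oplus>\<^bsub>H n\<^esub> h', b \<oplus>\<^bsub>B n\<^esub> b', k \<oplus>\<^bsub>B (n - 1)\<^esub> k')"
  by (simp add: decomposed_def direct_sum_simps)

lemma Z_neg:
  assumes "(h, b, k) \<in> carrier (Z n)"
  shows "\<ominus>\<^bsub>Z n\<^esub> (h, b, k) = (\<ominus>\<^bsub>H n\<^esub> h, \<ominus>\<^bsub>B n\<^esub> b, \<ominus>\<^bsub>B (n - 1)\<^esub> k)"
  using assms
  by (simp add: decomposed_def direct_sum_simps
      direct_sum_neg[OF homology_vectorspace BB.vectorspace_axioms]
      direct_sum_neg[OF boundary_space_vectorspace boundary_space_vectorspace])

lemma \<zeta>_cases: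
  assumes "x \<in> carrier (X n)"
  obtains h b k where "\<zeta> n x = (h, b, k)" "h \<in> carrier (H n)" "b \<in> carrier (B n)" "k \<in> carrier (B (n - 1))"
  using \<zeta>_closed[OF assms] by (cases "\<zeta> n x") (auto simp: Z_carrier)

lemma \<zeta>_t:
  assumes x: "x \<in> carrier (X n)" and "\<zeta> n x = (h, b, k)"
  shows "\<zeta> (n - 1) (t n x) = (\<zero>\<^bsub>H (n - 1)\<^esub>, k, \<zero>\<^bsub>B (n - 2)\<^esub>)"
proof -
  have "(h, b, k) \<in> carrier (Z n)" using \<zeta>_closed[OF x] assms(2) by simp
  then have "\<zeta> (n - 1) (t n (zeta_inv X \<zeta> n (h, b, k))) = (\<zero>\<^bsub>H (n - 1)\<^esub>, k, \<zero>\<^bsub>B (n - 2)\<^esub>)"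
    using decomposition by (fastforce simp: homology_decomposition_def)
  then show ?thesis
    using bij_betw_inv_into_left[OF \<zeta>_bij x] assms(2) by simp
qed

abbreviation "alpha \<equiv> alpha_at \<zeta>"
abbreviation "beta \<equiv> beta_at X t \<zeta>"
abbreviation "gamma \<equiv> gamma_at X t \<zeta>"

lemma alpha_lin: "linear_map K (X n) (H n) (alpha n)"
  unfolding alpha_at_def
  by (rule linear_map_comp[OF \<zeta>_lin[of n, unfolded decomposed_def]
        fst_linear[OF homology_vectorspace BB.vectorspace_axioms]])

lemma beta_lin: "linear_map K (H n) (X n) (beta n)"
  unfolding beta_at_def
  using linear_map_comp[OF inl_linear[OF homology_vectorspace BB.vectorspace_axioms[of n "n - 1"]] \<zeta>_inv_lin[of n, unfolded decomposed_def]]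
  by (simp add: direct_sum_simps)

lemma gamma_lin: "linear_map K (X n) (X (n + 1)) (gamma n)"
proof -
  have "linear_map K (X n) (direct_sum (B n) (B (n - 1))) (\<lambda>v. snd (\<zeta> n v))"
    by (rule linear_map_comp[OF \<zeta>_lin[of n, unfolded decomposed_def]
          snd_linear[OF homology_vectorspace BB.vectorspace_axioms]])
  then have "linear_map K (X n) (B n) (\<lambda>v. fst (snd (\<zeta> n v)))"
    by (rule linear_map_comp[OF _ fst_linear[OF boundary_space_vectorspace boundary_space_vectorspace]])
  then have "linear_map K (X n) (direct_sum (B (n + 1)) (B n)) (\<lambda>v. (\<zero>\<^bsub>B (n + 1)\<^esub>, fst (snd (\<zeta> n v))))"
    by (rule linear_map_comp[OF _ inr_linear[OF boundary_space_vectorspace boundary_space_vectorspace]])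
  then have "linear_map K (X n) (Z (n + 1)) (\<lambda>v. (\<zero>\<^bsub>H (n + 1)\<^esub>, \<zero>\<^bsub>B (n + 1)\<^esub>, fst (snd (\<zeta> n v))))"
    using linear_map_comp[OF _ inr_linear[OF homology_vectorspace BB.vectorspace_axioms]]
    by (fastforce simp: decomposed_def)
  then have "linear_map K (X n) (X (n + 1))
      (\<lambda>v. zeta_inv X \<zeta> (n + 1) (\<zero>\<^bsub>H (n + 1)\<^esub>, \<zero>\<^bsub>B (n + 1)\<^esub>, fst (snd (\<zeta> n v))))"
    by (rule linear_map_comp[OF _ \<zeta>_inv_lin])
  then show ?thesis unfolding gamma_at_def by (rule linear_map_uminus)
qed

lemmas maps_closed [simp] =
  linear_map_closed[OF alpha_lin] linear_map_closed[OF beta_lin] linear_map_closed[OF gamma_lin]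
  linear_map_closed[OF t_lin]

lemma \<zeta>_beta:
  assumes "h \<in> carrier (H n)"
  shows "\<zeta> n (beta n h) = (h, \<zero>\<^bsub>B n\<^esub>, \<zero>\<^bsub>B (n - 1)\<^esub>)"
  using assms by (simp add: beta_at_def Z_carrier)

lemma \<zeta>_gamma:
  assumes x: "x \<in> carrier (X n)" and e: "\<zeta> n x = (h, e, k)"
  shows "\<zeta> (n + 1) (gamma n x) = (\<zero>\<^bsub>H (n + 1)\<^esub>, \<zero>\<^bsub>B (n + 1)\<^esub>, \<ominus>\<^bsub>B n\<^esub> e)"
proof -
  have "e \<in> carrier (B n)" using \<zeta>_closed[OF x] e by (simp add: Z_carrier)
  then have *: "(\<zero>\<^bsub>H (n + 1)\<^esub>, \<zero>\<^bsub>B (n + 1)\<^esub>, e) \<in> carrier (Z (n + 1))" by (simp add: Z_carrier)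
  then show ?thesis
    using linear_map_closed[OF \<zeta>_inv_lin *] Z_neg[OF *] e
    by (simp add: gamma_at_def linear_map_neg[OF \<zeta>_lin])
qed

lemma alpha_beta: "h \<in> carrier (H n) \<Longrightarrow> alpha n (beta n h) = h"
  by (simp add: alpha_at_def \<zeta>_beta)

lemma alpha_gamma: "x \<in> carrier (X n) \<Longrightarrow> alpha (n + 1) (gamma n x) = \<zero>\<^bsub>H (n + 1)\<^esub>"
  by (cases "\<zeta> n x") (simp add: alpha_at_def \<zeta>_gamma)

lemma alpha_t: "x \<in> carrier (X n) \<Longrightarrow> alpha (n - 1) (t n x) = \<zero>\<^bsub>H (n - 1)\<^esub>"
  by (cases "\<zeta> n x") (simp add: alpha_at_def \<zeta>_t)

lemma t_beta:
  assumes h: "h \<in> carrier (H n)"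
  shows "t n (beta n h) = \<zero>\<^bsub>X (n - 1)\<^esub>"
proof (rule \<zeta>_eqI)
  show "\<zeta> (n - 1) (t n (beta n h)) = \<zeta> (n - 1) \<zero>\<^bsub>X (n - 1)\<^esub>"
    using h \<zeta>_t[OF _ \<zeta>_beta[OF h]] by (simp add: linear_map_zero[OF \<zeta>_lin] Z_zero)
qed (use h in auto)

lemma gamma_beta:
  assumes h: "h \<in> carrier (H n)"
  shows "gamma n (beta n h) = \<zero>\<^bsub>X (n + 1)\<^esub>"
proof (rule \<zeta>_eqI)
  show "\<zeta> (n + 1) (gamma n (beta n h)) = \<zeta> (n + 1) \<zero>\<^bsub>X (n + 1)\<^esub>"
    using h \<zeta>_gamma[OF _ \<zeta>_beta[OF h]] by (simp add: linear_map_zero[OF \<zeta>_lin] Z_zero)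
qed (use h in auto)

lemma gamma_gamma:
  assumes x: "x \<in> carrier (X n)"
  shows "gamma (n + 1) (gamma n x) = \<zero>\<^bsub>X (n + 2)\<^esub>"
proof -
  obtain h e k where "\<zeta> n x = (h, e, k)" by (metis prod_cases3)
  then have "\<zeta> (n + 1 + 1) (gamma (n + 1) (gamma n x)) = \<zeta> (n + 1 + 1) \<zero>\<^bsub>X (n + 1 + 1)\<^esub>"
    using \<zeta>_gamma[OF _ \<zeta>_gamma[OF x]] x by (simp add: linear_map_zero[OF \<zeta>_lin] Z_zero add.commute[of 1])
  then have "gamma (n + 1) (gamma n x) = \<zero>\<^bsub>X (n + 1 + 1)\<^esub>"
    using x linear_map_closed[OF gamma_lin, of "gamma n x" "n + 1"] by (intro \<zeta>_eqI) auto
  then show ?thesis by (simp add: add.assoc)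
qed

text \<open>
  In coordinates, \<open>t gamma x\<close> is \<open>(0, -b, 0)\<close> and \<open>gamma t x\<close> is \<open>(0, 0, -k)\<close>, so adding both to \<open>x\<close> leaves
  \<open>(h, 0, 0)\<close>.
\<close>

lemma beta_alpha:
  assumes x: "x \<in> carrier (X n)"
  shows "beta n (alpha n x) = x \<oplus>\<^bsub>X n\<^esub> t (n + 1) (gamma n x) \<oplus>\<^bsub>X n\<^esub> gamma (n - 1) (t n x)"
proof -
  obtain h e k where e: "\<zeta> n x = (h, e, k)" and
    cl: "h \<in> carrier (H n)" "e \<in> carrier (B n)" "k \<in> carrier (B (n - 1))"
    using \<zeta>_cases[OF x] by blast
  have tc: "t (n + 1) (gamma n x) \<in> carrier (X n)" "\<zeta> n (t (n + 1) (gamma n x)) = (\<zero>\<^bsub>H n\<^esub>, \<ominus>\<^bsub>B n\<^esub> e, \<zero>\<^bsub>B (n - 1)\<^esub>)"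
    using x linear_map_closed[OF t_lin, of "gamma n x" "n + 1"] \<zeta>_t[OF _ \<zeta>_gamma[OF x e]] by auto
  have ct: "gamma (n - 1) (t n x) \<in> carrier (X n)" "\<zeta> n (gamma (n - 1) (t n x)) = (\<zero>\<^bsub>H n\<^esub>, \<zero>\<^bsub>B n\<^esub>, \<ominus>\<^bsub>B (n - 1)\<^esub> k)"
    using x linear_map_closed[OF gamma_lin, of "t n x" "n - 1"] \<zeta>_gamma[OF _ \<zeta>_t[OF x e]] by auto
  show ?thesis
  proof (rule \<zeta>_eqI)
    show "\<zeta> n (beta n (alpha n x)) = \<zeta> n (x \<oplus>\<^bsub>X n\<^esub> t (n + 1) (gamma n x) \<oplus>\<^bsub>X n\<^esub> gamma (n - 1) (t n x))"
      using x tc ct e cl by (simp add: linear_map_add[OF \<zeta>_lin] \<zeta>_beta alpha_at_def Z_add B.r_neg)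
  qed (use x tc ct in auto)
qed

end


section \<open>The Conley complex\<close>

locale decomposed_graded_complex = perturbation_data C d \<zeta>
  for C :: "int \<Rightarrow> 'p::order \<Rightarrow> ('k, 'a) module"
    and d :: "int \<Rightarrow> ('p \<Rightarrow> 'a) \<Rightarrow> 'p \<Rightarrow> 'a"
    and \<zeta> :: "'p \<Rightarrow> int \<Rightarrow> 'a \<Rightarrow> 'a set \<times> 'a \<times> 'a" +
  fixes K :: "('k, 'r) ring_scheme"
  assumes well_founded: "\<not> (\<exists>s :: nat \<Rightarrow> 'p. \<forall>i. s (Suc i) < s i)"
    and graded: "graded_complex K C d"
    and decomposition: "\<And>p. homology_decomposition K (relative C p) (rel_diff C d p) (\<zeta> p)"
begin

lemma C_vs: "vectorspace K (C n p)"
  using graded by (simp add: graded_complex_def)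

lemma d_complex: "chain_complex K (total C) d"
  using graded by (simp add: graded_complex_def)

lemma d_lin: "linear_map K (dsum (C n)) (dsum (C (n - 1))) (d n)"
  using d_complex by (simp add: chain_complex_def)

lemma d_filtered: "filtered (C n) (C (n - 1)) (d n)"
  using graded by (simp add: graded_complex_def)

sublocale D: vectorspace K "dsum (C n)" for n
  using C_vs by (rule dsum_vectorspace)

lemma rel_diff_lin: "linear_map K (C n p) (C (n - 1) p) (rel_diff C d p n)"
  unfolding rel_diff_def component_def
  by (intro linear_map_comp[OF ginc_linear linear_map_comp[OF d_lin gproj_linear]] C_vs)

lemma d_hat_lin: "linear_map K (dsum (C n)) (dsum (C (n - 1))) (d_hat n)"
  unfolding d_hat_def by (rule graded_sum_linear[OF rel_diff_lin])

lemma d_hat_apply: "x \<in> carrier (dsum (C n)) \<Longrightarrow> d_hat n x = (\<lambda>p. rel_diff C d p n (x p))"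
  unfolding d_hat_def by (rule graded_sum_apply[OF rel_diff_lin])

lemma \<delta>_lin: "linear_map K (dsum (C n)) (dsum (C (n - 1))) (\<delta> n)"
  unfolding \<delta>_def a_minus_def by (intro linear_map_sum d_lin linear_map_uminus d_hat_lin)

lemma d_split:
  assumes "x \<in> carrier (dsum (C n))"
  shows "d n x = d_hat n x \<oplus>\<^bsub>dsum (C (n - 1))\<^esub> \<delta> n x"
proof -
  have "d n x \<in> carrier (dsum (C (n - 1)))" "d_hat n x \<in> carrier (dsum (C (n - 1)))"
    using assms linear_map_closed[OF d_lin] linear_map_closed[OF d_hat_lin] by auto
  then show ?thesis by (simp add: \<delta>_def a_minus_def D.a_lcomm D.r_neg)
qed

text \<open>
  The entries of \<open>d\<close> and \<open>d_hat\<close> from grade \<open>q\<close> to \<open>q\<close> agree, and those to grades not below or equal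
  to \<open>q\<close> vanish for both; so only entries to grades \<open>p < q\<close> survive in \<open>\<delta>\<close>.
\<close>

lemma \<delta>_lowers:
  assumes v: "v \<in> carrier (C n q)"
  shows "\<delta> n (ginc (C n) q v) \<in> supported (C (n - 1)) {..<q}"
proof -
  interpret V: vectorspace K "C m p" for m p by (rule C_vs)
  let ?x = "ginc (C n) q v"
  have x: "?x \<in> carrier (dsum (C n))" by (rule ginc_closed[of K "C n", OF C_vs v])
  have cl: "d n ?x \<in> carrier (dsum (C (n - 1)))" "d_hat n ?x \<in> carrier (dsum (C (n - 1)))"
    using x linear_map_closed[OF d_lin] linear_map_closed[OF d_hat_lin] by auto
  have "\<delta> n ?x p = \<zero>\<^bsub>C (n - 1) p\<^esub>" if "\<not> p < q" for p
  proof -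
    have "\<delta> n ?x p = d n ?x p \<ominus>\<^bsub>C (n - 1) p\<^esub> d_hat n ?x p"
      using cl dsum_neg[of K "C (n - 1)", OF C_vs cl(2)] by (simp add: \<delta>_def a_minus_def dsum_simps)
    also have "\<dots> = \<zero>\<^bsub>C (n - 1) p\<^esub>"
    proof (cases "p = q")
      case True
      then have "d n ?x p = d_hat n ?x p"
        by (simp add: d_hat_apply[OF x]) (simp add: rel_diff_def component_def gproj_def ginc_def)
      moreover have "d_hat n ?x p \<in> carrier (C (n - 1) p)" using cl by (simp add: dsum_simps)
      ultimately show ?thesis by (simp add: a_minus_def V.r_neg)
    next
      case False
      with that have "\<not> p \<le> q" by auto
      then have "d n ?x p = \<zero>\<^bsub>C (n - 1) p\<^esub>"
        using d_filtered v by (auto simp: filtered_def component_def gproj_def)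
      moreover have "d_hat n ?x p = \<zero>\<^bsub>C (n - 1) p\<^esub>"
        using False linear_map_zero[OF rel_diff_lin] by (simp add: d_hat_apply[OF x]) (simp add: ginc_def)
      ultimately show ?thesis by (simp add: a_minus_def)
    qed
    finally show ?thesis .
  qed
  then show ?thesis using linear_map_closed[OF \<delta>_lin x] by (auto simp: supported_def)
qed

text \<open>
  The entry of \<open>dd = 0\<close> at \<open>(p, p)\<close>: applied to \<open>v\<close> of grade \<open>p\<close>, \<open>d\<close> gives \<open>t v\<close> in grade \<open>p\<close> plus \<open>\<delta>v\<close> in
  grades below \<open>p\<close>, and \<open>d\<close> cannot bring the latter back up to \<open>p\<close>.
\<close>

lemma relative_complex: "chain_complex K (relative C p) (rel_diff C d p)"
proof -
  interpret V: vectorspace K "C m r" for m r by (rule C_vs)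
  have "rel_diff C d p (n - 1) (rel_diff C d p n v) = \<zero>\<^bsub>C (n - 2) p\<^esub>" if v: "v \<in> carrier (C n p)" for n v
  proof -
    let ?x = "ginc (C n) p v" and ?t = "rel_diff C d p n v"
    have x: "?x \<in> carrier (dsum (C n))" by (rule ginc_closed[of K "C n", OF C_vs v])
    have t: "?t \<in> carrier (C (n - 1) p)" by (rule linear_map_closed[OF rel_diff_lin v])
    have g: "ginc (C (n - 1)) p ?t \<in> carrier (dsum (C (n - 1)))"
      by (rule ginc_closed[of K "C (n - 1)", OF C_vs t])
    have low: "d (n - 1) (\<delta> n ?x) \<in> supported (C (n - 1 - 1)) {..<p}"
      by (rule filtered_supported[OF d_filtered d_lin C_vs C_vs _ \<delta>_lowers[OF v]]) auto
    have "d_hat n ?x = ginc (C (n - 1)) p ?t"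
      by (simp add: d_hat_apply[OF x]) (auto simp: ginc_def linear_map_zero[OF rel_diff_lin])
    then have "d n ?x = ginc (C (n - 1)) p ?t \<oplus>\<^bsub>dsum (C (n - 1))\<^esub> \<delta> n ?x"
      using d_split[OF x] by simp
    then have "d (n - 1) (d n ?x) = d (n - 1) (ginc (C (n - 1)) p ?t) \<oplus>\<^bsub>dsum (C (n - 1 - 1))\<^esub> d (n - 1) (\<delta> n ?x)"
      using linear_map_add[OF d_lin g linear_map_closed[OF \<delta>_lin x]] by simp
    moreover have "d (n - 1) (d n ?x) = \<zero>\<^bsub>dsum (C (n - 2))\<^esub>"
      using d_complex x by (simp add: chain_complex_def)
    ultimately have "\<zero>\<^bsub>C (n - 2) p\<^esub> = d (n - 1) (ginc (C (n - 1)) p ?t) p \<oplus>\<^bsub>C (n - 2) p\<^esub> d (n - 1) (\<delta> n ?x) p"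
      by (simp add: dsum_simps fun_eq_iff)
    also have "d (n - 1) (\<delta> n ?x) p = \<zero>\<^bsub>C (n - 2) p\<^esub>"
      using low by (simp add: supported_def)
    also have "d (n - 1) (ginc (C (n - 1)) p ?t) p = rel_diff C d p (n - 1) ?t"
      by (simp add: rel_diff_def component_def gproj_def)
    finally show ?thesis
      using linear_map_closed[OF rel_diff_lin t] by simp
  qed
  then show ?thesis
    by (simp add: chain_complex_def relative_def rel_diff_lin)
qed

sublocale rel: decomposed_complex K "relative C p" "rel_diff C d p" "\<zeta> p" for p
  by (intro decomposed_complex.intro relative_complex decomposition)

lemma Cbar_vs: "vectorspace K (Cbar n p)"
  unfolding Cbar_def by (rule rel.homology_vectorspace)

lemma pointwise_lin:
  shows alpha_at_lin: "linear_map K (C n p) (Cbar n p) (alpha_at (\<zeta> p) n)"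
    and beta_at_lin: "linear_map K (Cbar n p) (C n p) (beta_at (relative C p) (rel_diff C d p) (\<zeta> p) n)"
    and gamma_at_lin: "linear_map K (C n p) (C (n + 1) p) (gamma_at (relative C p) (rel_diff C d p) (\<zeta> p) n)"
  using rel.alpha_lin[of p n] rel.beta_lin[of p n] rel.gamma_lin[of p n]
  by (simp_all add: Cbar_def relative_def)

lemma \<alpha>_lin: "linear_map K (dsum (C n)) (dsum (Cbar n)) (\<alpha> n)"
  and \<beta>_lin: "linear_map K (dsum (Cbar n)) (dsum (C n)) (\<beta> n)"
  and \<gamma>_lin: "linear_map K (dsum (C n)) (dsum (C (n + 1))) (\<gamma> n)"
  unfolding \<alpha>_def \<beta>_def \<gamma>_def by (rule graded_sum_linear[OF pointwise_lin(1)]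
      graded_sum_linear[OF pointwise_lin(2)] graded_sum_linear[OF pointwise_lin(3)])+

lemma \<alpha>_filtered: "filtered (C n) (Cbar n) (\<alpha> n)"
  and \<beta>_filtered: "filtered (Cbar n) (C n) (\<beta> n)"
  and \<gamma>_filtered: "filtered (C n) (C (n + 1)) (\<gamma> n)"
  unfolding \<alpha>_def \<beta>_def \<gamma>_def by (rule graded_sum_filtered[OF pointwise_lin(1)]
      graded_sum_filtered[OF pointwise_lin(2)] graded_sum_filtered[OF pointwise_lin(3)])+

lemma \<alpha>_apply: "x \<in> carrier (dsum (C n)) \<Longrightarrow> \<alpha> n x = (\<lambda>p. alpha_at (\<zeta> p) n (x p))"
  unfolding \<alpha>_def by (rule graded_sum_apply[OF alpha_at_lin])

lemma \<beta>_apply: "y \<in> carrier (dsum (Cbar n)) \<Longrightarrow>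
    \<beta> n y = (\<lambda>p. beta_at (relative C p) (rel_diff C d p) (\<zeta> p) n (y p))"
  unfolding \<beta>_def by (rule graded_sum_apply[OF beta_at_lin])

lemma \<gamma>_apply: "x \<in> carrier (dsum (C n)) \<Longrightarrow>
    \<gamma> n x = (\<lambda>p. gamma_at (relative C p) (rel_diff C d p) (\<zeta> p) n (x p))"
  unfolding \<gamma>_def by (rule graded_sum_apply[OF gamma_at_lin])

lemma \<gamma>\<delta>_lin: "linear_map K (dsum (C n)) (dsum (C n)) (\<gamma>\<delta> n)"
  unfolding \<gamma>\<delta>_def using linear_map_comp[OF \<delta>_lin \<gamma>_lin] by simp

lemma \<gamma>\<delta>_lowers:
  assumes v: "v \<in> carrier (C n q)"
  shows "\<gamma>\<delta> n (ginc (C n) q v) \<in> supported (C n) {..<q}"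
proof -
  have "\<gamma> (n - 1) (\<delta> n (ginc (C n) q v)) \<in> supported (C (n - 1 + 1)) {..<q}"
    by (rule filtered_supported[OF \<gamma>_filtered \<gamma>_lin C_vs C_vs _ \<delta>_lowers[OF v]]) auto
  then show ?thesis
    by (simp add: \<gamma>\<delta>_def)
qed

sublocale N: locally_nilpotent K "dsum (C n)" "\<gamma>\<delta> n" for n
  by (rule locally_nilpotent_if_lowering[OF well_founded \<gamma>\<delta>_lin C_vs \<gamma>\<delta>_lowers])

definition A :: "int \<Rightarrow> ('p \<Rightarrow> 'a) \<Rightarrow> 'p \<Rightarrow> 'a" where
  "A n = N.resolvent n"

lemma one_minus_eq: "one_minus_\<gamma>\<delta> n = (\<lambda>x. x \<ominus>\<^bsub>dsum (C n)\<^esub> \<gamma>\<delta> n x)"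
  by (simp add: one_minus_\<gamma>\<delta>_def fun_eq_iff)

lemma S_eq: "\<S> n x = \<delta> n (A n x)"
  by (simp add: \<S>_def A_def N.resolvent_def one_minus_eq)

lemma inverse: inverse_exists
  unfolding inverse_exists_def one_minus_eq using N.one_minus_bij by blast

text \<open>
  All terms with \<open>i \<ge> N\<close> vanish once \<open>(\<gamma>\<delta>)^N x = 0\<close>. The sum over \<open>{..<N}\<close> from the geometric series
  may contain further zero terms, which are dropped to match the index set of the statement.
\<close>

lemma series: \<S>_is_series
  unfolding \<S>_is_series_def
proof (intro allI ballI)
  fix n x assume x: "x \<in> carrier (dsum (C n))"
  let ?f = "\<lambda>i. \<delta> n ((\<gamma>\<delta> n ^^ i) x)"
  let ?I = "{i. ?f i \<noteq> \<zero>\<^bsub>dsum (C (n - 1))\<^esub>}"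
  obtain N where N: "(\<gamma>\<delta> n ^^ N) x = \<zero>\<^bsub>dsum (C n)\<^esub>" using N.nilpotent[OF x] by blast
  have f: "?f i \<in> carrier (dsum (C (n - 1)))" for i
    by (rule linear_map_closed[OF \<delta>_lin N.pow_closed[OF x]])
  have sub: "?I \<subseteq> {..<N}"
  proof
    fix i assume i: "i \<in> ?I"
    show "i \<in> {..<N}"
    proof (rule ccontr)
      assume "i \<notin> {..<N}"
      then have "(\<gamma>\<delta> n ^^ i) x = (\<gamma>\<delta> n ^^ (i - N)) ((\<gamma>\<delta> n ^^ N) x)"
        by (simp flip: funpow_add[unfolded comp_def, THEN fun_cong])
      then have "(\<gamma>\<delta> n ^^ i) x = \<zero>\<^bsub>dsum (C n)\<^esub>" by (simp add: N)
      with i show False by (simp add: linear_map_zero[OF \<delta>_lin])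
    qed
  qed
  have "\<S> n x = \<delta> n (\<Oplus>\<^bsub>dsum (C n)\<^esub>i\<in>{..<N}. (\<gamma>\<delta> n ^^ i) x)"
    by (simp add: S_eq A_def N.resolvent_series[OF x N])
  also have "\<dots> = (\<Oplus>\<^bsub>dsum (C (n - 1))\<^esub>i\<in>{..<N}. ?f i)"
    by (rule linear_map_finsum[OF \<delta>_lin]) (use x in auto)
  also have "\<dots> = (\<Oplus>\<^bsub>dsum (C (n - 1))\<^esub>i\<in>?I. ?f i)"
    by (rule D.add.finprod_mono_neutral_cong_right) (use sub f in auto)
  finally show "finite ?I \<and> \<S> n x = (\<Oplus>\<^bsub>dsum (C (n - 1))\<^esub>i\<in>?I. ?f i)"
    using finite_subset[OF sub] by simp
qed

lemma component_closed:
  "x \<in> carrier (dsum (C n)) \<Longrightarrow> x p \<in> carrier (relative C p n)"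
  "y \<in> carrier (dsum (Cbar n)) \<Longrightarrow> y p \<in> carrier (homology (relative C p) (rel_diff C d p) n)"
  by (simp_all add: dsum_simps relative_def Cbar_def)

text \<open>
  The unperturbed identities hold grade by grade, where they are those of the relative complexes.
\<close>

sublocale P: perturbation K "total C" "total Cbar" d d_hat \<delta> \<alpha> \<beta> \<gamma> A
proof (rule perturbation.intro, goal_cases)
  case (8 x n)
  then show ?case
    using linear_map_closed[OF d_hat_lin 8] rel.t_t[OF component_closed(1)[OF 8]]
    by (simp add: d_hat_apply dsum_simps(1)) (simp add: relative_def)
next
  case (9 y n)
  then show ?case
    using linear_map_closed[OF \<beta>_lin 9] rel.t_beta[OF component_closed(2)[OF 9]]
    by (simp add: d_hat_apply \<beta>_apply dsum_simps(1)) (simp add: relative_def)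
next
  case (10 x n)
  then show ?case
    using linear_map_closed[OF d_hat_lin 10] rel.alpha_t[OF component_closed(1)[OF 10]]
    by (simp add: d_hat_apply \<alpha>_apply dsum_simps(1)) (simp add: Cbar_def)
next
  case (11 y n)
  then show ?case
    using linear_map_closed[OF \<beta>_lin 11] rel.alpha_beta[OF component_closed(2)[OF 11]]
    by (simp add: \<alpha>_apply \<beta>_apply)
next
  case (12 x n)
  then show ?case
    using linear_map_closed[OF \<alpha>_lin 12] linear_map_closed[OF \<gamma>_lin 12]
      linear_map_closed[OF d_hat_lin 12] rel.beta_alpha[OF component_closed(1)[OF 12]]
      \<gamma>_apply[of "d_hat n x" "n - 1"]
    by (simp add: \<alpha>_apply \<beta>_apply d_hat_apply dsum_simps(2)) (simp add: \<gamma>_apply relative_def)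
next
  case (13 x n)
  then show ?case
    using linear_map_closed[OF \<gamma>_lin 13] rel.alpha_gamma[OF component_closed(1)[OF 13]]
    by (simp add: \<gamma>_apply \<alpha>_apply dsum_simps(1)) (simp add: Cbar_def)
next
  case (14 y n)
  then show ?case
    using linear_map_closed[OF \<beta>_lin 14] rel.gamma_beta[OF component_closed(2)[OF 14]]
    by (simp add: \<gamma>_apply \<beta>_apply dsum_simps(1)) (simp add: relative_def)
next
  case (15 x n)
  then show ?case
    using linear_map_closed[OF \<gamma>_lin 15] rel.gamma_gamma[OF component_closed(1)[OF 15]]
    by (simp add: \<gamma>_apply dsum_simps(1)) (simp add: relative_def)
next
  case (16 x n)
  then show ?case by (simp add: A_def N.resolvent_closed)
next
  case (17 x n)
  then show ?case using N.resolvent_fix[OF 17] by (simp add: A_def \<gamma>\<delta>_def)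
next
  case (18 x n x')
  then show ?case using N.resolvent_unique[OF 18(1,2)] by (simp add: A_def \<gamma>\<delta>_def)
qed (simp_all add: d_hat_lin \<delta>_lin \<alpha>_lin \<beta>_lin \<gamma>_lin d_complex d_split)

lemma bar_eq: "dbar = P.dbar" "\<alpha>bar = P.\<alpha>bar" "\<beta>bar = P.\<beta>bar" "\<gamma>bar = P.\<gamma>bar"
  by (simp_all add: fun_eq_iff P.S_def S_eq dbar_def P.dbar_def \<alpha>bar_def P.\<alpha>bar_def
      \<beta>bar_def P.\<beta>bar_def \<gamma>bar_def P.\<gamma>bar_def)

lemma \<gamma>\<delta>_supported:
  assumes "x \<in> supported (C n) {..q}"
  shows "\<gamma>\<delta> n x \<in> supported (C n) {..q}"
proof (rule supported_map[OF \<gamma>\<delta>_lin C_vs C_vs _ assms])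
  fix r v assume r: "r \<in> {..q}" and v: "v \<in> carrier (C n r)"
  show "\<gamma>\<delta> n (ginc (C n) r v) \<in> supported (C n) {..q}"
    using \<gamma>\<delta>_lowers[OF v] supported_mono[of "{..<r}" "{..q}"] r by fastforce
qed

text \<open>The inverse preserves support because it is a finite sum of powers of \<open>\<gamma>\<delta>\<close>.\<close>

lemma A_supported:
  assumes x: "x \<in> supported (C n) {..q}"
  shows "A n x \<in> supported (C n) {..q}"
proof -
  obtain N where N: "(\<gamma>\<delta> n ^^ N) x = \<zero>\<^bsub>dsum (C n)\<^esub>"
    using N.nilpotent[OF supportedD[OF x]] by blast
  have "(\<gamma>\<delta> n ^^ i) x \<in> supported (C n) {..q}" for i
    by (induction i) (auto simp: x \<gamma>\<delta>_supported)
  then show ?thesis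
    unfolding A_def N.resolvent_series[OF supportedD[OF x] N]
    by (intro supported_finsum[OF C_vs])
qed

lemma \<delta>_supported:
  assumes x: "x \<in> supported (C n) {..q}"
  shows "\<delta> n x \<in> supported (C (n - 1)) {..<q}"
proof (rule supported_map[OF \<delta>_lin C_vs C_vs _ x])
  fix r v assume r: "r \<in> {..q}" and v: "v \<in> carrier (C n r)"
  show "\<delta> n (ginc (C n) r v) \<in> supported (C (n - 1)) {..<q}"
    using \<delta>_lowers[OF v] supported_mono[of "{..<r}" "{..<q}"] r by fastforce
qed

lemma \<beta>_supported:
  assumes "v \<in> carrier (Cbar n q)"
  shows "\<beta> n (ginc (Cbar n) q v) \<in> supported (C n) {..q}"
  by (rule filtered_supported[OF \<beta>_filtered \<beta>_lin Cbar_vs C_vs _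
        ginc_supported[of K "Cbar n", OF Cbar_vs assms]]) auto

lemma dbar_lowers:
  assumes v: "v \<in> carrier (Cbar n q)"
  shows "dbar n (ginc (Cbar n) q v) \<in> supported (Cbar (n - 1)) {..<q}"
  unfolding dbar_def S_eq
  by (rule filtered_supported[OF \<alpha>_filtered \<alpha>_lin C_vs Cbar_vs _
        \<delta>_supported[OF A_supported[OF \<beta>_supported[OF v]]]]) auto

lemma \<beta>bar_filtered: "filtered (Cbar n) (C n) (\<beta>bar n)"
proof (rule filteredI)
  fix q v assume v: "v \<in> carrier (Cbar n q)"
  show "\<beta>bar n (ginc (Cbar n) q v) \<in> supported (C n) {..q}"
    using P.\<beta>bar_eq[of "ginc (Cbar n) q v" n] ginc_closed[of K "Cbar n", OF Cbar_vs v]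
      A_supported[OF \<beta>_supported[OF v]] by (simp add: bar_eq)
qed

lemma \<gamma>bar_supported:
  assumes v: "v \<in> carrier (C n q)"
  shows "\<gamma>bar n (ginc (C n) q v) \<in> supported (C (n + 1)) {..q}"
proof -
  have "\<gamma> n (ginc (C n) q v) \<in> supported (C (n + 1)) {..q}"
    by (rule filtered_supported[OF \<gamma>_filtered \<gamma>_lin C_vs C_vs _
        ginc_supported[of K "C n", OF C_vs v]]) auto
  then show ?thesis
    using P.\<gamma>bar_eq[of "ginc (C n) q v" n] ginc_closed[of K "C n", OF C_vs v] A_supported
    by (simp add: bar_eq)
qed

lemma \<gamma>bar_filtered: "filtered (C n) (C (n + 1)) (\<gamma>bar n)"
  by (rule filteredI[OF \<gamma>bar_supported])

lemma \<alpha>bar_filtered: "filtered (C n) (Cbar n) (\<alpha>bar n)"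
proof (rule filteredI)
  fix q v assume v: "v \<in> carrier (C n q)"
  let ?x = "ginc (C n) q v"
  have x: "?x \<in> supported (C n) {..q}" by (rule ginc_supported[of K "C n", OF C_vs v]) simp
  have "\<gamma> n ?x \<in> supported (C (n + 1)) {..q}"
    by (rule filtered_supported[OF \<gamma>_filtered \<gamma>_lin C_vs C_vs _ x]) auto
  from \<delta>_supported[OF A_supported[OF this]]
  have "\<S> (n + 1) (\<gamma> n ?x) \<in> supported (C n) {..q}"
    using supported_mono[of "{..<q}" "{..q}" "C n"] by (auto simp: S_eq subset_iff less_imp_le)
  then have "\<alpha> n (\<S> (n + 1) (\<gamma> n ?x)) \<in> supported (Cbar n) {..q}"
    by (rule filtered_supported[OF \<alpha>_filtered \<alpha>_lin C_vs Cbar_vs, rotated]) auto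
  moreover have "\<alpha> n ?x \<in> supported (Cbar n) {..q}"
    by (rule filtered_supported[OF \<alpha>_filtered \<alpha>_lin C_vs Cbar_vs _ x]) auto
  ultimately show "\<alpha>bar n ?x \<in> supported (Cbar n) {..q}"
    unfolding \<alpha>bar_def by (intro supported_add[OF Cbar_vs])
qed

theorem contraction: "filtered_contraction K C d Cbar dbar \<alpha>bar \<beta>bar \<gamma>bar"
  unfolding filtered_contraction_def
  using P.contraction_bar \<alpha>bar_filtered \<beta>bar_filtered \<gamma>bar_filtered by (simp add: bar_eq)

lemma dbar_graded: "graded_complex K Cbar dbar"
proof -
  have "filtered (Cbar n) (Cbar (n - 1)) (dbar n)" for n
  proof (rule filteredI)
    fix q v assume "v \<in> carrier (Cbar n q)"
    then show "dbar n (ginc (Cbar n) q v) \<in> supported (Cbar (n - 1)) {..q}"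
      using dbar_lowers supported_mono[of "{..<q}" "{..q}" "Cbar (n - 1)"] by fastforce
  qed
  then show ?thesis
    using P.dbar_complex by (simp add: graded_complex_def Cbar_vs bar_eq)
qed

lemma dbar_strict: "strict Cbar dbar"
  using dbar_lowers
  by (auto simp: strict_def rel_diff_def component_def gproj_def supported_def)

end

text \<open>
  Since \<open>fg\<close> is the identity, the zero map serves as the homotopy on the small complex.
\<close>

lemma filtered_contraction_equivalence:
  assumes con: "filtered_contraction K C d C' d' f g h" and C': "graded_complex K C' d'"
  shows "filtered_homotopy_equivalence K C d C' d' f g h (\<lambda>n y. \<zero>\<^bsub>dsum (C' (n + 1))\<^esub>)"
proof -
  have vs: "vectorspace K (C' n p)" for n p using C' by (simp add: graded_complex_def)
  interpret D: vectorspace K "dsum (C' n)" for n using vs by (rule dsum_vectorspace)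
  have d': "linear_map K (dsum (C' n)) (dsum (C' (n - 1))) (d' n)" for n
    using C' by (simp add: graded_complex_def chain_complex_def)
  have zero: "linear_map K (dsum (C' n)) (dsum (C' (n + 1))) (\<lambda>y. \<zero>\<^bsub>dsum (C' (n + 1))\<^esub>)" for n
    by (rule linear_mapI) (auto intro: D.vectorspace_axioms)
  have fil: "filtered (C' n) (C' (n + 1)) (\<lambda>y. \<zero>\<^bsub>dsum (C' (n + 1))\<^esub>)" for n
    by (rule filteredI[OF supported_zero[OF vs]])
  have "d' (n + 1) \<zero>\<^bsub>dsum (C' (n + 1))\<^esub> = \<zero>\<^bsub>dsum (C' n)\<^esub>" for n
    using linear_map_zero[OF d', of "n + 1"] by simp
  then show ?thesis
    using con fil zero
    by (simp add: filtered_contraction_def contraction_def filtered_homotopy_equivalence_def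
        homotopy_equivalence_def null_homotopy_of_difference_def)
qed

theorem theorem1p1:
  fixes K :: "('k, 'r) ring_scheme"
    and C :: "int \<Rightarrow> 'p::order \<Rightarrow> ('k, 'a) module"
    and d :: "int \<Rightarrow> ('p \<Rightarrow> 'a) \<Rightarrow> 'p \<Rightarrow> 'a"
    and \<zeta> :: "'p \<Rightarrow> int \<Rightarrow> 'a \<Rightarrow> 'a set \<times> 'a \<times> 'a"
  assumes "\<not> (\<exists>s :: nat \<Rightarrow> 'p. \<forall>i. s (Suc i) < s i)"
    and "graded_complex K C d"
    and "\<And>p. homology_decomposition K (relative C p) (rel_diff C d p) (\<zeta> p)"
  shows "perturbation_data.inverse_exists C d \<zeta>
    \<and> perturbation_data.\<S>_is_series C d \<zeta>
    \<and> conley_complex K C d (perturbation_data.Cbar C d) (perturbation_data.dbar C d \<zeta>)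
    \<and> filtered_contraction K C d (perturbation_data.Cbar C d) (perturbation_data.dbar C d \<zeta>)
        (perturbation_data.\<alpha>bar C d \<zeta>) (perturbation_data.\<beta>bar C d \<zeta>) (perturbation_data.\<gamma>bar C d \<zeta>)"
proof -
  interpret decomposed_graded_complex C d \<zeta> K
    by (rule decomposed_graded_complex.intro) (fact assms)+
  have "conley_complex K C d Cbar dbar"
    unfolding conley_complex_def
    using dbar_graded dbar_strict filtered_contraction_equivalence[OF contraction dbar_graded] by blast
  then show ?thesis
    using inverse series contraction by blast
qed

end
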